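(* The symmetric inverse monoid $I_{\mathbb N}$ endowed with any $T_1$ second countable semigroup topology is homeomorphic to the Baire space $\mathbb N^{\mathbb N}$.
   Context: $I_{\mathbb N}$ is the symmetric inverse monoid on $\mathbb N$: all bijections between subsets of $\mathbb N$ (including the empty map), with multiplication the composition of binary relations. A topology on $I_{\mathbb N}$ is a semigroup topology if the multiplication $I_{\mathbb N}\times I_{\mathbb N}\to I_{\mathbb N}$ is (jointly) continuous. The Baire space $\mathbb N^{\mathbb N}$ carries the product topology of discrete copies of $\mathbb N$. *)

theory Defs
  imports "HOL-Analysis.Analysis"
begin

text \<open>
  A partial map on \<open>\<nat>\<close> is represented by its graph. The product of \<open>f\<close> and \<open>g\<close> in the monoid is
  \<open>f O g\<close>, so maps act on the right: \<open>(x, z) \<in> f O g\<close> iff \<open>(x, y) \<in> f\<close> and \<open>(y, z) \<in> g\<close> for some \<open>y\<close>.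
\<close>

definition symmetric_inverse_monoid :: "(nat \<times> nat) set set" where
  "symmetric_inverse_monoid =
     {f. \<exists>A B h. bij_betw h A B \<and> f = {(x, h x) | x. x \<in> A}}"

definition semigroup_topology_on :: "'a set \<Rightarrow> ('a \<Rightarrow> 'a \<Rightarrow> 'a) \<Rightarrow> 'a topology \<Rightarrow> bool" where
  "semigroup_topology_on S m T \<longleftrightarrow>
     topspace T = S \<and> continuous_map (prod_topology T T) T (\<lambda>(x, y). m x y)"

definition baire_space :: "(nat \<Rightarrow> nat) topology" where
  "baire_space = product_topology (\<lambda>_. discrete_topology UNIV) UNIV"

lemma symmetric_inverse_monoid_iff:
  "f \<in> symmetric_inverse_monoid \<longleftrightarrow> single_valued f \<and> single_valued (f\<inverse>)"
proof
  assume "f \<in> symmetric_inverse_monoid"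
  then show "single_valued f \<and> single_valued (f\<inverse>)"
    by (auto simp: symmetric_inverse_monoid_def bij_betw_def single_valued_def dest: inj_onD)
next
  assume f: "single_valued f \<and> single_valued (f\<inverse>)"
  define h where "h x = (THE y. (x, y) \<in> f)" for x
  have h: "h x = y" if "(x, y) \<in> f" for x y
    unfolding h_def using f that by (blast intro: the_equality dest: single_valuedD)
  have "inj_on h (Domain f)"
    using f h by (intro inj_onI) (metis Domain.cases converseI single_valuedD)
  then have "bij_betw h (Domain f) (h ` Domain f)"
    by (simp add: bij_betw_def)
  moreover have "f = {(x, h x) | x. x \<in> Domain f}"
    using h by fastforce
  ultimately show "f \<in> symmetric_inverse_monoid"
    unfolding symmetric_inverse_monoid_def by blast
qed

lemma symmetric_inverse_monoid_relcomp:
  "\<lbrakk>f \<in> symmetric_inverse_monoid; g \<in> symmetric_inverse_monoid\<rbrakk>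
    \<Longrightarrow> f O g \<in> symmetric_inverse_monoid"
  by (simp add: symmetric_inverse_monoid_iff converse_relcomp single_valued_relcomp)

end

theory Submission
  imports Defs
begin

text \<open>
  Compare \<open>T\<close> with two topologies: \<open>agree\<close> (agreement on an initial segment, undefinedness included)
  and \<open>biagree\<close> (the same for the map and its inverse).

  Second countability makes \<open>T\<close> coarser than the \<open>biagree\<close> topology. An approximation of \<open>s\<close> is a
  product of two factors that respect partitions into finite blocks, and a sequence respecting such a
  partition can be spread over the binary tree so that divergence in \<open>T\<close> would produce an uncountable
  discrete subspace.

  The \<open>T\<^sub>1\<close> axiom together with continuity at \<open>{} O Id O {} = {}\<close> makes all sets \<open>{h. x \<notin> Domain h}\<close>
  open or all sets \<open>{h. y \<notin> Range h}\<close> open. Passing to inverses, assume the former; then \<open>T\<close> is finer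
  than the \<open>agree\<close> topology. What distinguishes \<open>T\<close> from it is which finite sets are hit by the ranges
  of maps arbitrarily near to a given one, and recording this yields a countable base of
  \<open>T\<close>-open sets that are closed in the \<open>agree\<close> topology. As the latter is complete and nonempty
  open sets take infinitely many values at some point, these sets can be organised into
  an infinitely branching Lusin scheme, which identifies \<open>T\<close> with the Baire space.
\<close>

section \<open>Lusin schemes and the Baire space\<close>

text \<open>The index function takes the current cell as an argument, so cells of one stage may be
  split in unrelated ways; \<open>\<alpha>\<close> selects one fibre at each stage.\<close>

primrec lusin_cell :: "('a set \<Rightarrow> nat \<Rightarrow> 'a \<Rightarrow> nat) \<Rightarrow> 'a set \<Rightarrow> (nat \<Rightarrow> nat) \<Rightarrow> nat \<Rightarrow> 'a set" where
  "lusin_cell \<iota> X \<alpha> 0 = X"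
| "lusin_cell \<iota> X \<alpha> (Suc n) = {g \<in> lusin_cell \<iota> X \<alpha> n. \<iota> (lusin_cell \<iota> X \<alpha> n) n g = \<alpha> n}"

text \<open>Following \<open>h\<close> itself through the splittings avoids a circular definition of
  addresses by cells and of cells by addresses.\<close>

primrec point_cell :: "('a set \<Rightarrow> nat \<Rightarrow> 'a \<Rightarrow> nat) \<Rightarrow> 'a set \<Rightarrow> 'a \<Rightarrow> nat \<Rightarrow> 'a set" where
  "point_cell \<iota> X h 0 = X"
| "point_cell \<iota> X h (Suc n) =
     {g \<in> point_cell \<iota> X h n. \<iota> (point_cell \<iota> X h n) n g = \<iota> (point_cell \<iota> X h n) n h}"

definition address :: "('a set \<Rightarrow> nat \<Rightarrow> 'a \<Rightarrow> nat) \<Rightarrow> 'a set \<Rightarrow> 'a \<Rightarrow> nat \<Rightarrow> nat" where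
  "address \<iota> X h n = \<iota> (point_cell \<iota> X h n) n h"

lemma lusin_cell_address: "lusin_cell \<iota> X (address \<iota> X h) n = point_cell \<iota> X h n"
  by (induction n) (auto simp: address_def)

lemma in_point_cell: "h \<in> X \<Longrightarrow> h \<in> point_cell \<iota> X h n"
  by (induction n) auto

lemma point_cell_antimono: "m \<le> n \<Longrightarrow> point_cell \<iota> X h n \<subseteq> point_cell \<iota> X h m"
  by (rule lift_Suc_antimono_le[of "point_cell \<iota> X h"]) auto

lemma point_cell_eq:
  assumes "g \<in> point_cell \<iota> X h n" "m \<le> n"
  shows "point_cell \<iota> X g m = point_cell \<iota> X h m"
  using assms(2)
proof (induction m)
  case (Suc m)
  then have eq: "point_cell \<iota> X g m = point_cell \<iota> X h m" by simp
  have "g \<in> point_cell \<iota> X h (Suc m)"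
    using point_cell_antimono[OF Suc.prems, of \<iota> X h] assms(1) by blast
  then have "\<iota> (point_cell \<iota> X h m) m g = \<iota> (point_cell \<iota> X h m) m h" by simp
  then show ?case by (simp add: eq)
qed simp

lemma address_eq: "g \<in> point_cell \<iota> X h (Suc n) \<Longrightarrow> address \<iota> X g n = address \<iota> X h n"
  using point_cell_eq[of g \<iota> X h "Suc n" n] by (simp add: address_def)

lemma lusin_cell_cong:
  "(\<And>i. i < n \<Longrightarrow> \<alpha> i = \<beta> i) \<Longrightarrow> lusin_cell \<iota> X \<alpha> n = lusin_cell \<iota> X \<beta> n"
  by (induction n) auto

lemma address_unique:
  assumes "\<And>n. h \<in> lusin_cell \<iota> X \<alpha> n"
  shows "address \<iota> X h = \<alpha>"
proof -
  have eq: "lusin_cell \<iota> X \<alpha> n = point_cell \<iota> X h n" for n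
  proof (induction n)
    case (Suc n)
    have "\<iota> (lusin_cell \<iota> X \<alpha> n) n h = \<alpha> n"
      using assms[of "Suc n"] by simp
    with Suc show ?case by auto
  qed auto
  show ?thesis
  proof
    fix n
    show "address \<iota> X h n = \<alpha> n"
      using assms[of "Suc n"] eq[of n] by (simp add: address_def)
  qed
qed

lemma openin_baire_cylinder: "openin baire_space {\<alpha>. \<forall>i<n. \<alpha> i = \<beta> i}"
proof -
  have "openin baire_space (PiE UNIV (\<lambda>i. if i < n then {\<beta> i} else UNIV))"
    unfolding baire_space_def
    by (rule product_topology_basis) (auto intro: finite_subset[of _ "{..<n}"])
  moreover have "PiE UNIV (\<lambda>i. if i < n then {\<beta> i} else UNIV) = {\<alpha>. \<forall>i<n. \<alpha> i = \<beta> i}"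
    by (auto simp: PiE_iff split: if_splits)
  ultimately show ?thesis by simp
qed

text \<open>The homeomorphism is \<open>address\<close>: \<open>complete\<close> gives surjectivity,
  openness of the cells gives continuity. In place of shrinking diameters, \<open>small\<close> asks
  for one stage at which every cell around \<open>h\<close> is split finely enough for
  \<open>U\<close>; this yields openness and, with T1, injectivity.\<close>

lemma homeomorphic_baire_space:
  fixes \<iota> :: "'a set \<Rightarrow> nat \<Rightarrow> 'a \<Rightarrow> nat"
  assumes t1: "t1_space T"
    and top: "topspace T \<in> \<A>" "topspace T \<noteq> {}"
    and op: "\<And>C. C \<in> \<A> \<Longrightarrow> openin T C"
    and surj: "\<And>C n. \<lbrakk>C \<in> \<A>; C \<noteq> {}\<rbrakk> \<Longrightarrow> \<iota> C n ` C = UNIV"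
    and fiber: "\<And>C n k. \<lbrakk>C \<in> \<A>; C \<noteq> {}\<rbrakk> \<Longrightarrow> {g \<in> C. \<iota> C n g = k} \<in> \<A>"
    and small: "\<And>U h. \<lbrakk>openin T U; h \<in> U\<rbrakk> \<Longrightarrow>
                  \<exists>n. \<forall>C\<in>\<A>. h \<in> C \<longrightarrow> {g \<in> C. \<iota> C n g = \<iota> C n h} \<subseteq> U"
    and complete: "\<And>C. \<lbrakk>\<And>n. C n \<in> \<A> \<and> C n \<noteq> {};
                     \<And>n. \<exists>k. C (Suc n) = {g \<in> C n. \<iota> (C n) n g = k}\<rbrakk> \<Longrightarrow> (\<Inter>n. C n) \<noteq> {}"
  shows "T homeomorphic_space baire_space"
proof -
  let ?X = "topspace T" and ?\<phi> = "address \<iota> (topspace T)"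
  let ?C = "lusin_cell \<iota> (topspace T)" and ?P = "point_cell \<iota> (topspace T)"
  have C: "?C \<alpha> n \<in> \<A> \<and> ?C \<alpha> n \<noteq> {}" for \<alpha> n
  proof (induction n)
    case (Suc n)
    then obtain g where "g \<in> ?C \<alpha> n" "\<iota> (?C \<alpha> n) n g = \<alpha> n"
      using surj[of "?C \<alpha> n" n] by (metis UNIV_I imageE)
    with Suc fiber show ?case by auto
  qed (use top in auto)
  have P: "?P h n \<in> \<A>" for h n
    using C lusin_cell_address by metis
  have inX: "h \<in> ?X" if "h \<in> ?C \<alpha> n" for h \<alpha> n
    using that C op openin_subset by blast
  have surj\<phi>: "\<exists>h\<in>?X. ?\<phi> h = \<alpha> \<and> (\<forall>n. h \<in> ?C \<alpha> n)" for \<alpha>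
  proof -
    have "(\<Inter>n. ?C \<alpha> n) \<noteq> {}"
      using C by (intro complete) auto
    then obtain h where "\<And>n. h \<in> ?C \<alpha> n" by auto
    then show ?thesis
      using address_unique inX by metis
  qed
  have sub: "g \<in> U" if U: "openin T U" "h \<in> U" "g \<in> ?X"
      and n: "\<forall>C\<in>\<A>. h \<in> C \<longrightarrow> {g \<in> C. \<iota> C n g = \<iota> C n h} \<subseteq> U"
      and eq: "\<forall>i<Suc n. ?\<phi> g i = ?\<phi> h i" for U g h n
  proof -
    have hX: "h \<in> ?X" using U openin_subset by blast
    have "g \<in> ?P g (Suc n)" using in_point_cell U by metis
    also have "?P g (Suc n) = ?P h (Suc n)"
      using lusin_cell_cong[of "Suc n" "?\<phi> g" "?\<phi> h"] eq lusin_cell_address by metis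
    finally have "g \<in> {g \<in> ?P h n. \<iota> (?P h n) n g = \<iota> (?P h n) n h}" by simp
    moreover have "{g \<in> ?P h n. \<iota> (?P h n) n g = \<iota> (?P h n) n h} \<subseteq> U"
      using n P[of h n] in_point_cell[OF hX, of \<iota> n] by blast
    ultimately show ?thesis by blast
  qed
  have "homeomorphic_map T baire_space ?\<phi>"
  proof (rule bijective_open_imp_homeomorphic_map)
    show "continuous_map T baire_space ?\<phi>"
      unfolding baire_space_def continuous_map_componentwise_UNIV
    proof
      fix n
      show "continuous_map T (discrete_topology UNIV) (\<lambda>h. ?\<phi> h n)"
        unfolding continuous_map_def
      proof (intro conjI allI impI)
        fix V :: "nat set"
        show "openin T {h \<in> ?X. ?\<phi> h n \<in> V}"
        proof (subst openin_subopen, intro ballI)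
          fix h assume h: "h \<in> {h \<in> ?X. ?\<phi> h n \<in> V}"
          have "openin T (?P h (Suc n))" "h \<in> ?P h (Suc n)"
            using P[of h "Suc n"] op in_point_cell[of h ?X] h by blast+
          moreover have "?P h (Suc n) \<subseteq> {h \<in> ?X. ?\<phi> h n \<in> V}"
          proof
            fix g assume g: "g \<in> ?P h (Suc n)"
            then have "g \<in> ?X"
              using openin_subset[OF op[OF P]] by blast
            then show "g \<in> {h \<in> ?X. ?\<phi> h n \<in> V}"
              using h address_eq[OF g] by simp
          qed
          ultimately show "\<exists>W. openin T W \<and> h \<in> W \<and> W \<subseteq> {h \<in> ?X. ?\<phi> h n \<in> V}"
            by blast
        qed
      qed auto
    qed
    show "open_map T baire_space ?\<phi>"
      unfolding open_map_def
    proof (intro allI impI)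
      fix U assume U: "openin T U"
      show "openin baire_space (?\<phi> ` U)"
      proof (subst openin_subopen, intro ballI)
        fix \<alpha> assume "\<alpha> \<in> ?\<phi> ` U"
        then obtain h where h: "h \<in> U" "\<alpha> = ?\<phi> h" by auto
        then obtain n where n: "\<forall>C\<in>\<A>. h \<in> C \<longrightarrow> {g \<in> C. \<iota> C n g = \<iota> C n h} \<subseteq> U"
          using small U by blast
        have "{\<beta>. \<forall>i<Suc n. \<beta> i = \<alpha> i} \<subseteq> ?\<phi> ` U"
        proof
          fix \<beta> assume \<beta>: "\<beta> \<in> {\<beta>. \<forall>i<Suc n. \<beta> i = \<alpha> i}"
          obtain g where "g \<in> ?X" "?\<phi> g = \<beta>"
            using surj\<phi> by blast
          moreover from this have "g \<in> U"
            using sub[OF U h(1) _ n, of g] \<beta> h(2) by simp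
          ultimately show "\<beta> \<in> ?\<phi> ` U" by blast
        qed
        then show "\<exists>W. openin baire_space W \<and> \<alpha> \<in> W \<and> W \<subseteq> ?\<phi> ` U"
          using openin_baire_cylinder[of "Suc n" \<alpha>] by blast
      qed
    qed
    show "?\<phi> ` ?X = topspace baire_space"
      using surj\<phi> by (auto simp: baire_space_def) (metis imageI)
    show "inj_on ?\<phi> ?X"
    proof (rule inj_onI, rule ccontr)
      fix g h assume gh: "g \<in> ?X" "h \<in> ?X" "?\<phi> g = ?\<phi> h" "g \<noteq> h"
      then obtain U where U: "openin T U" "h \<in> U" "g \<notin> U"
        using t1 unfolding t1_space_def by metis
      then obtain n where "\<forall>C\<in>\<A>. h \<in> C \<longrightarrow> {g \<in> C. \<iota> C n g = \<iota> C n h} \<subseteq> U"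
        using small by blast
      from sub[OF U(1,2) gh(1) this] gh(3) U(3) show False by simp
    qed
  qed
  then show ?thesis
    by (rule homeomorphic_map_imp_homeomorphic_space)
qed

section \<open>Partial bijections\<close>

abbreviation "SIM \<equiv> symmetric_inverse_monoid"

lemma SIM_I:
  assumes "\<And>x y z. \<lbrakk>(x, y) \<in> f; (x, z) \<in> f\<rbrakk> \<Longrightarrow> y = z"
    and "\<And>x y z. \<lbrakk>(x, z) \<in> f; (y, z) \<in> f\<rbrakk> \<Longrightarrow> x = y"
  shows "f \<in> SIM"
  unfolding symmetric_inverse_monoid_iff single_valued_def using assms by blast

lemma SIM_fun: "\<lbrakk>f \<in> SIM; (x, y) \<in> f; (x, z) \<in> f\<rbrakk> \<Longrightarrow> y = z"
  unfolding symmetric_inverse_monoid_iff single_valued_def by blast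

lemma SIM_inj: "\<lbrakk>f \<in> SIM; (x, z) \<in> f; (y, z) \<in> f\<rbrakk> \<Longrightarrow> x = y"
  unfolding symmetric_inverse_monoid_iff single_valued_def by blast

lemma SIM_subset: "\<lbrakk>f \<in> SIM; g \<subseteq> f\<rbrakk> \<Longrightarrow> g \<in> SIM"
  by (rule SIM_I) (blast dest: SIM_fun SIM_inj)+

lemma SIM_converse [simp]: "f\<inverse> \<in> SIM \<longleftrightarrow> f \<in> SIM"
  by (auto simp: symmetric_inverse_monoid_iff)

lemma SIM_Id [simp]: "Id \<in> SIM" and SIM_Id_on [simp]: "Id_on A \<in> SIM"
  and SIM_empty [simp]: "{} \<in> SIM" and SIM_single [simp]: "{(x, y)} \<in> SIM"
  by (auto intro!: SIM_I)

lemma SIM_finite_restrict: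
  assumes "f \<in> SIM" "finite A"
  shows "finite (f \<inter> A \<times> UNIV)" "finite (f \<inter> UNIV \<times> A)"
proof -
  have "inj_on fst (f \<inter> A \<times> UNIV)" "inj_on snd (f \<inter> UNIV \<times> A)"
    using assms by (auto simp: inj_on_def dest: SIM_fun SIM_inj)
  moreover have "finite (fst ` (f \<inter> A \<times> UNIV))" "finite (snd ` (f \<inter> UNIV \<times> A))"
    using assms by (auto intro: finite_subset[of _ A])
  ultimately show "finite (f \<inter> A \<times> UNIV)" "finite (f \<inter> UNIV \<times> A)"
    using finite_imageD by blast+
qed

lemma SIM_finite_Domain: "\<lbrakk>f \<in> SIM; finite (Domain f)\<rbrakk> \<Longrightarrow> finite f"
  using SIM_finite_restrict(1)[of f "Domain f"] by (auto elim: rev_finite_subset)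

lemma infinite_Compl_nat: "finite (A :: nat set) \<Longrightarrow> infinite (- A)"
  using finite_compl infinite_UNIV_nat by blast

section \<open>Agreement on initial segments\<close>

definition agree :: "nat \<Rightarrow> (nat \<times> nat) set \<Rightarrow> (nat \<times> nat) set \<Rightarrow> bool" where
  "agree n f g \<longleftrightarrow> (\<forall>x y. x < n \<longrightarrow> (x, y) \<in> f \<longleftrightarrow> (x, y) \<in> g)"

definition biagree :: "nat \<Rightarrow> (nat \<times> nat) set \<Rightarrow> (nat \<times> nat) set \<Rightarrow> bool" where
  "biagree n f g \<longleftrightarrow> (\<forall>x y. x < n \<or> y < n \<longrightarrow> (x, y) \<in> f \<longleftrightarrow> (x, y) \<in> g)"

lemma agree_refl [simp]: "agree n f f"
  by (simp add: agree_def)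

lemma agree_trans: "\<lbrakk>agree n f g; agree n g h\<rbrakk> \<Longrightarrow> agree n f h"
  by (simp add: agree_def)

lemma agree_sym: "agree n f g \<Longrightarrow> agree n g f"
  by (simp add: agree_def)

lemma agree_mono: "\<lbrakk>agree n f g; m \<le> n\<rbrakk> \<Longrightarrow> agree m f g"
  by (simp add: agree_def)

lemma biagree_imp_agree: "biagree n f g \<Longrightarrow> agree n f g"
  by (simp add: agree_def biagree_def)

lemma biagree_mono: "\<lbrakk>biagree n f g; m \<le> n\<rbrakk> \<Longrightarrow> biagree m f g"
  by (auto simp: biagree_def)

text \<open>Keep the finitely many arrows of \<open>g\<close> that meet \<open>{..<n}\<close> at
  either end and match the remaining cofinite sets by a bijection. Only points below
  \<open>n\<close> can then be missed.\<close>

lemma SIM_finite_extension: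
  assumes "g \<in> SIM"
  obtains g' where "g' \<in> SIM" "biagree n g' g" "finite (- Range g')"
proof -
  define g0 where "g0 = g \<inter> {..<n} \<times> UNIV \<union> g \<inter> UNIV \<times> {..<n}"
  have fin: "finite g0"
    unfolding g0_def using SIM_finite_restrict[OF assms] by auto
  define A where "A = - ({..<n} \<union> Domain g0)"
  define B where "B = - ({..<n} \<union> Range g0)"
  have inf: "infinite A" "infinite B"
    unfolding A_def B_def using fin
    by (intro infinite_Compl_nat; simp add: finite_Domain finite_Range)+
  obtain f where f: "bij_betw f A B"
    using bij_betw_trans[OF bij_betw_inv_into[OF bij_enumerate[OF inf(1)]] bij_enumerate[OF inf(2)]]
    by blast
  define g' where "g' = g0 \<union> {(x, f x) | x. x \<in> A}"
  have fB: "f x \<in> B" if "x \<in> A" for x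
    using f that by (auto simp: bij_betw_def)
  have g0: "g0 \<in> SIM"
    using SIM_subset[OF assms] by (auto simp: g0_def)
  have "g' \<in> SIM"
    unfolding g'_def
  proof (rule SIM_I)
    fix x y z
    assume "(x, y) \<in> g0 \<union> {(x, f x) | x. x \<in> A}" "(x, z) \<in> g0 \<union> {(x, f x) | x. x \<in> A}"
    then show "y = z"
      using SIM_fun[OF g0] by (auto simp: A_def)
  next
    fix x y z
    assume "(x, z) \<in> g0 \<union> {(x, f x) | x. x \<in> A}" "(y, z) \<in> g0 \<union> {(x, f x) | x. x \<in> A}"
    then show "x = y"
      using SIM_inj[OF g0] fB f by (auto simp: B_def bij_betw_def dest: inj_onD)
  qed
  moreover have "biagree n g' g"
    unfolding biagree_def
  proof (intro allI impI)
    fix x y assume xy: "x < n \<or> y < n"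
    have "(x, y) \<notin> {(x, f x) | x. x \<in> A}"
    proof
      assume "(x, y) \<in> {(x, f x) | x. x \<in> A}"
      then have "x \<in> A" "y \<in> B" using fB by auto
      with xy show False by (auto simp: A_def B_def)
    qed
    then show "(x, y) \<in> g' \<longleftrightarrow> (x, y) \<in> g"
      using xy by (auto simp: g'_def g0_def)
  qed
  moreover have "- Range g' \<subseteq> {..<n}"
  proof
    fix y assume y: "y \<in> - Range g'"
    show "y \<in> {..<n}"
    proof (rule ccontr)
      assume "y \<notin> {..<n}"
      then have "y \<in> B" using y by (auto simp: B_def g'_def)
      then obtain x where "x \<in> A" "y = f x" using f by (auto simp: bij_betw_def)
      then show False using y by (auto simp: g'_def)
    qed
  qed
  then have "finite (- Range g')" by (rule finite_subset) simp
  ultimately show ?thesis using that by blast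
qed

lemma SIM_preimage_bound:
  assumes "f \<in> SIM" "finite Y"
  obtains n where "\<And>x y. \<lbrakk>(x, y) \<in> f; y \<in> Y\<rbrakk> \<Longrightarrow> x < n"
proof -
  have "finite (fst ` (f \<inter> UNIV \<times> Y))"
    using SIM_finite_restrict(2)[OF assms] by simp
  then obtain n where "\<forall>x\<in>fst ` (f \<inter> UNIV \<times> Y). x < n"
    using finite_nat_set_iff_bounded by blast
  then show ?thesis by (intro that[of n]) force
qed

section \<open>Continuity with respect to two-sided agreement\<close>

lemma singleton_relcomp:
  "{(x, x)} O h O {(y, y)} = (if (x, y) \<in> h then {(x, y)} else {})"
  by auto

section \<open>Branches of the binary tree\<close>

definition prefix_code :: "nat set \<Rightarrow> nat \<Rightarrow> nat \<Rightarrow> nat" where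
  "prefix_code A k i = prod_encode (i, set_encode (A \<inter> {..<k}))"

lemma prefix_code_eq_iff:
  "prefix_code A k i = prefix_code B l j \<longleftrightarrow> i = j \<and> A \<inter> {..<k} = B \<inter> {..<l}"
  by (simp add: prefix_code_def set_encode_eq)

definition first_diff :: "nat set \<Rightarrow> nat set \<Rightarrow> nat" where
  "first_diff A B = (LEAST n. n \<in> A \<longleftrightarrow> n \<notin> B)"

lemma first_diff:
  assumes "A \<noteq> B"
  shows "first_diff A B \<in> A \<longleftrightarrow> first_diff A B \<notin> B"
  unfolding first_diff_def by (rule LeastI_ex) (use assms in blast)

lemma below_first_diff: "n < first_diff A B \<Longrightarrow> n \<in> A \<longleftrightarrow> n \<in> B"
  unfolding first_diff_def using not_less_Least by blast

lemma prefix_eq_iff: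
  assumes "A \<noteq> B"
  shows "A \<inter> {..<k} = B \<inter> {..<k} \<longleftrightarrow> k \<le> first_diff A B"
proof
  show "k \<le> first_diff A B" if "A \<inter> {..<k} = B \<inter> {..<k}"
    using first_diff[OF assms] that by (metis Int_iff lessThan_iff not_le)
  show "A \<inter> {..<k} = B \<inter> {..<k}" if "k \<le> first_diff A B"
    using below_first_diff[of _ A B] that by auto
qed

text \<open>A prefix long enough to differ from \<open>B\<close> already shows where it separates,
  so \<open>branch_step\<close> can select the replacement map from the prefix alone.\<close>

lemma first_diff_prefix:
  assumes "A \<inter> {..<k} \<noteq> B \<inter> {..<k}"
  shows "first_diff (A \<inter> {..<k}) B = first_diff A B"
proof -
  have ne: "A \<noteq> B" using assms by blast
  have less: "first_diff A B < k"
    using prefix_eq_iff[OF ne, of k] assms by simp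
  show ?thesis
    unfolding first_diff_def[of "A \<inter> {..<k}"]
  proof (rule Least_equality)
    show "first_diff A B \<in> A \<inter> {..<k} \<longleftrightarrow> first_diff A B \<notin> B"
      using first_diff[OF ne] less by auto
    fix n assume "n \<in> A \<inter> {..<k} \<longleftrightarrow> n \<notin> B"
    then show "first_diff A B \<le> n"
      using below_first_diff[of n A B] less by (metis Int_iff lessThan_iff not_le order.strict_trans)
  qed
qed

text \<open>The points \<open>prefix_code A (\<beta> i) i\<close> form a copy of \<open>\<nat>\<close> along the branch \<open>A\<close> of the binary tree.
  On that copy \<open>branch_map \<beta> \<gamma> s c B\<close> acts as \<open>s\<close> if \<open>A = B\<close>, and as \<open>c n\<close> if the two
  branches separate at level \<open>n\<close>. It is well defined because the moves of \<open>s\<close> and \<open>c n\<close> do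
  not change the length of the prefix, that is, they take \<open>\<beta>\<close> to \<open>\<gamma>\<close>.\<close>

definition branch_step ::
    "(nat \<times> nat) set \<Rightarrow> (nat \<Rightarrow> (nat \<times> nat) set) \<Rightarrow> nat set \<Rightarrow> nat \<Rightarrow> nat set \<Rightarrow> (nat \<times> nat) set"
  where "branch_step s c B k P = (if P = B \<inter> {..<k} then s else c (first_diff P B))"

definition branch_map ::
    "(nat \<Rightarrow> nat) \<Rightarrow> (nat \<Rightarrow> nat) \<Rightarrow> (nat \<times> nat) set \<Rightarrow> (nat \<Rightarrow> (nat \<times> nat) set) \<Rightarrow> nat set \<Rightarrow> (nat \<times> nat) set"
  where "branch_map \<beta> \<gamma> s c B =
    {(prefix_code A (\<beta> i) i, prefix_code A (\<gamma> j) j) | A i j.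
       (i, j) \<in> branch_step s c B (\<beta> i) (A \<inter> {..<\<beta> i})}"

definition branch_in :: "(nat \<Rightarrow> nat) \<Rightarrow> nat set \<Rightarrow> (nat \<times> nat) set" where
  "branch_in \<beta> A = {(i, prefix_code A (\<beta> i) i) | i. True}"

lemma branch_in_SIM: "branch_in \<beta> A \<in> SIM"
  by (rule SIM_I) (auto simp: branch_in_def prefix_code_eq_iff)

lemma branch_map_conj:
  "branch_in \<beta> A O branch_map \<beta> \<gamma> s c B O (branch_in \<gamma> A)\<inverse> =
     {(i, j). (i, j) \<in> branch_step s c B (\<beta> i) (A \<inter> {..<\<beta> i})}"
    (is "?L = ?R")
proof (rule set_eqI)
  fix p :: "nat \<times> nat"
  obtain i j where p: "p = (i, j)" by force
  have "p \<in> ?L \<longleftrightarrow> (prefix_code A (\<beta> i) i, prefix_code A (\<gamma> j) j) \<in> branch_map \<beta> \<gamma> s c B"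
    by (auto simp: branch_in_def p)
  also have "\<dots> \<longleftrightarrow> p \<in> ?R"
  proof
    assume "(prefix_code A (\<beta> i) i, prefix_code A (\<gamma> j) j) \<in> branch_map \<beta> \<gamma> s c B"
    then obtain A' i' j' where "prefix_code A (\<beta> i) i = prefix_code A' (\<beta> i') i'"
        "prefix_code A (\<gamma> j) j = prefix_code A' (\<gamma> j') j'"
        "(i', j') \<in> branch_step s c B (\<beta> i') (A' \<inter> {..<\<beta> i'})"
      unfolding branch_map_def by blast
    then have "i' = i" "j' = j" "A' \<inter> {..<\<beta> i} = A \<inter> {..<\<beta> i}"
        "(i', j') \<in> branch_step s c B (\<beta> i') (A' \<inter> {..<\<beta> i'})"
      unfolding prefix_code_eq_iff by blast+
    then show "p \<in> ?R" by (simp add: p)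
  next
    assume "p \<in> ?R"
    then show "(prefix_code A (\<beta> i) i, prefix_code A (\<gamma> j) j) \<in> branch_map \<beta> \<gamma> s c B"
      unfolding branch_map_def p by blast
  qed
  finally show "p \<in> ?L \<longleftrightarrow> p \<in> ?R" .
qed

lemma branch_map_conj_same:
  "branch_in \<beta> A O branch_map \<beta> \<gamma> s c A O (branch_in \<gamma> A)\<inverse> = s"
  unfolding branch_map_conj by (simp add: branch_step_def)

text \<open>Let \<open>n\<close> be the separation level. Indices with
  \<open>\<beta> i \<le> n\<close> see a common prefix and move by \<open>s\<close>, which equals
  \<open>c n\<close> there by assumption; all others see the separation and move by
  \<open>c n\<close>.\<close>

lemma branch_map_conj_diff:
  assumes "\<And>n i j. \<beta> i \<le> n \<Longrightarrow> (i, j) \<in> c n \<longleftrightarrow> (i, j) \<in> s" and "A \<noteq> B"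
  shows "branch_in \<beta> A O branch_map \<beta> \<gamma> s c B O (branch_in \<gamma> A)\<inverse> = c (first_diff A B)"
proof -
  have "(i, j) \<in> branch_step s c B (\<beta> i) (A \<inter> {..<\<beta> i}) \<longleftrightarrow> (i, j) \<in> c (first_diff A B)" for i j
  proof (cases "\<beta> i \<le> first_diff A B")
    case True
    then show ?thesis
      using assms(1)[OF True, of j] prefix_eq_iff[OF assms(2), of "\<beta> i"] by (simp add: branch_step_def)
  next
    case False
    then have "A \<inter> {..<\<beta> i} \<noteq> B \<inter> {..<\<beta> i}"
      using prefix_eq_iff[OF assms(2)] by blast
    then show ?thesis
      using first_diff_prefix by (simp add: branch_step_def)
  qed
  then show ?thesis
    unfolding branch_map_conj by auto
qed

context
  fixes \<beta> \<gamma> :: "nat \<Rightarrow> nat" and s :: "(nat \<times> nat) set" and c :: "nat \<Rightarrow> (nat \<times> nat) set"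
  assumes s: "s \<in> SIM" and c: "\<And>n. c n \<in> SIM"
    and loc_s: "\<And>i j. (i, j) \<in> s \<Longrightarrow> \<beta> i = \<gamma> j"
    and loc_c: "\<And>n i j. (i, j) \<in> c n \<Longrightarrow> \<beta> i = \<gamma> j"
begin

lemma branch_step_SIM: "branch_step s c B k P \<in> SIM"
  using s c by (simp add: branch_step_def)

lemma branch_step_local: "(i, j) \<in> branch_step s c B k P \<Longrightarrow> \<beta> i = \<gamma> j"
  using loc_s loc_c by (auto simp: branch_step_def split: if_splits)

lemma branch_map_SIM: "branch_map \<beta> \<gamma> s c B \<in> SIM"
proof (rule SIM_I)
  fix x y z
  assume "(x, y) \<in> branch_map \<beta> \<gamma> s c B" and "(x, z) \<in> branch_map \<beta> \<gamma> s c B"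
  then obtain A i j A' j' where *: "y = prefix_code A (\<gamma> j) j" "z = prefix_code A' (\<gamma> j') j'"
      "A \<inter> {..<\<beta> i} = A' \<inter> {..<\<beta> i}" "(i, j) \<in> branch_step s c B (\<beta> i) (A \<inter> {..<\<beta> i})"
      "(i, j') \<in> branch_step s c B (\<beta> i) (A' \<inter> {..<\<beta> i})"
    unfolding branch_map_def by (auto simp: prefix_code_eq_iff)
  have "j = j'" using *(3-5) branch_step_SIM SIM_fun by metis
  then show "y = z" using * branch_step_local[OF *(4)] by (simp add: prefix_code_eq_iff)
next
  fix x y z
  assume "(x, z) \<in> branch_map \<beta> \<gamma> s c B" and "(y, z) \<in> branch_map \<beta> \<gamma> s c B"
  then obtain A i j A' i' where *: "x = prefix_code A (\<beta> i) i" "y = prefix_code A' (\<beta> i') i'"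
      "A \<inter> {..<\<gamma> j} = A' \<inter> {..<\<gamma> j}" "(i, j) \<in> branch_step s c B (\<beta> i) (A \<inter> {..<\<beta> i})"
      "(i', j) \<in> branch_step s c B (\<beta> i') (A' \<inter> {..<\<beta> i'})"
    unfolding branch_map_def by (auto simp: prefix_code_eq_iff)
  \<comment> \<open>A common target prefix is thus also a common source prefix, so both arrows come
    from the same \<open>branch_step\<close>.\<close>
  have \<beta>: "\<beta> i = \<gamma> j" "\<beta> i' = \<gamma> j"
    using branch_step_local *(4,5) by blast+
  have "i = i'" using *(3-5) \<beta> branch_step_SIM SIM_inj by metis
  then show "x = y" using * \<beta> by (simp add: prefix_code_eq_iff)
qed

end

section \<open>Translations and second countability\<close>

locale sim_topology =
  fixes T :: "(nat \<times> nat) set topology"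
  assumes semigroup: "semigroup_topology_on symmetric_inverse_monoid (O) T"
    and t1: "t1_space T"
    and second_countable: "second_countable T"
begin

lemma topspace [simp]: "topspace T = SIM"
  using semigroup by (simp add: semigroup_topology_on_def)

lemma open_in_SIM: "\<lbrakk>openin T U; f \<in> U\<rbrakk> \<Longrightarrow> f \<in> SIM"
  using openin_subset by fastforce

lemma mult_nhds:
  assumes "openin T U" "f O g \<in> U" "f \<in> SIM" "g \<in> SIM"
  obtains V W where "openin T V" "openin T W" "f \<in> V" "g \<in> W"
    "\<And>f' g'. \<lbrakk>f' \<in> V; g' \<in> W\<rbrakk> \<Longrightarrow> f' O g' \<in> U"
proof -
  have "continuous_map (prod_topology T T) T (\<lambda>(x, y). x O y)"
    using semigroup by (simp add: semigroup_topology_on_def)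
  then have "openin (prod_topology T T) {p \<in> SIM \<times> SIM. (case p of (x, y) \<Rightarrow> x O y) \<in> U}"
    using openin_continuous_map_preimage[OF _ assms(1)] by fastforce
  moreover have "(f, g) \<in> {p \<in> SIM \<times> SIM. (case p of (x, y) \<Rightarrow> x O y) \<in> U}"
    using assms by simp
  ultimately obtain V W where VW: "openin T V" "openin T W" "f \<in> V" "g \<in> W"
      "V \<times> W \<subseteq> {p \<in> SIM \<times> SIM. (case p of (x, y) \<Rightarrow> x O y) \<in> U}"
    unfolding openin_prod_topology_alt by meson
  show ?thesis
  proof (rule that[OF VW(1-4)])
    show "f' O g' \<in> U" if "f' \<in> V" "g' \<in> W" for f' g'
      using VW(5) that by auto
  qed
qed

lemma openin_left_translation:
  assumes "openin T U" "f \<in> SIM"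
  shows "openin T {g \<in> SIM. f O g \<in> U}"
proof (subst openin_subopen, intro ballI)
  fix g assume "g \<in> {g \<in> SIM. f O g \<in> U}"
  then have g: "g \<in> SIM" "f O g \<in> U" by auto
  obtain V W where "openin T W" "f \<in> V" "g \<in> W" "\<And>f' g'. \<lbrakk>f' \<in> V; g' \<in> W\<rbrakk> \<Longrightarrow> f' O g' \<in> U"
    by (rule mult_nhds[OF assms(1) g(2) assms(2) g(1)]) blast
  then show "\<exists>W. openin T W \<and> g \<in> W \<and> W \<subseteq> {g \<in> SIM. f O g \<in> U}"
    using open_in_SIM by (intro exI[of _ W]) auto
qed

lemma openin_right_translation:
  assumes "openin T U" "g \<in> SIM"
  shows "openin T {f \<in> SIM. f O g \<in> U}"
proof (subst openin_subopen, intro ballI)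
  fix f assume "f \<in> {f \<in> SIM. f O g \<in> U}"
  then have f: "f \<in> SIM" "f O g \<in> U" by auto
  obtain V W where "openin T V" "f \<in> V" "g \<in> W" "\<And>f' g'. \<lbrakk>f' \<in> V; g' \<in> W\<rbrakk> \<Longrightarrow> f' O g' \<in> U"
    by (rule mult_nhds[OF assms(1) f(2) f(1) assms(2)]) blast
  then show "\<exists>V. openin T V \<and> f \<in> V \<and> V \<subseteq> {f \<in> SIM. f O g \<in> U}"
    using open_in_SIM by (intro exI[of _ V]) auto
qed

lemma openin_two_sided:
  assumes "openin T U" "f \<in> SIM" "g \<in> SIM"
  shows "openin T {x \<in> SIM. f O x O g \<in> U}"
proof -
  have "openin T {x \<in> SIM. x O g \<in> {y \<in> SIM. f O y \<in> U}}"
    by (intro openin_right_translation openin_left_translation assms)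
  moreover have "{x \<in> SIM. x O g \<in> {y \<in> SIM. f O y \<in> U}} = {x \<in> SIM. f O x O g \<in> U}"
    using assms symmetric_inverse_monoid_relcomp by auto
  ultimately show ?thesis by simp
qed

text \<open>Choose for every \<open>B\<close> a base set between \<open>y B\<close> and
  \<open>N B\<close>. There are more sets of naturals than base sets, so one is chosen twice, and it
  puts \<open>y B\<close> into \<open>N A\<close>.\<close>

lemma no_discrete_branches:
  assumes "\<And>B :: nat set. openin T (N B) \<and> y B \<in> N B"
  obtains A B where "A \<noteq> B" "y B \<in> N A"
proof -
  obtain \<B> where \<B>: "countable \<B>" "\<And>U x. \<lbrakk>openin T U; x \<in> U\<rbrakk> \<Longrightarrow> \<exists>V\<in>\<B>. x \<in> V \<and> V \<subseteq> U"
    using second_countable unfolding second_countable_def by metis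
  have "\<exists>V. V \<in> \<B> \<and> y B \<in> V \<and> V \<subseteq> N B" for B
    using \<B>(2) assms by metis
  then obtain G where G: "\<And>B. G B \<in> \<B> \<and> y B \<in> G B \<and> G B \<subseteq> N B" by metis
  have "\<not> inj G"
  proof
    assume "inj G"
    then have "inj (to_nat_on \<B> \<circ> G)"
      using G \<B>(1) by (auto simp: inj_def)
    then have "surj (inv (to_nat_on \<B> \<circ> G))" by (rule inj_imp_surj_inv)
    then show False
      using Cantors_theorem[of "UNIV :: nat set"] by auto
  qed
  then obtain A B where "A \<noteq> B" "G A = G B" by (auto simp: inj_def)
  then show ?thesis using G[of A] G[of B] that by blast
qed

text \<open>If \<open>a\<close> did not converge to \<open>s\<close>, then for a subsequence \<open>c\<close> outside \<open>U\<close> the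
  uncountably many maps \<open>branch_map \<beta> \<gamma> s c B\<close> would form a discrete subspace: the two-sided translate that reads off branch \<open>A\<close> sends only
  the map of \<open>A\<close> itself into \<open>U\<close>.\<close>

lemma local_convergence:
  fixes \<beta> \<gamma> :: "nat \<Rightarrow> nat"
  assumes U: "openin T U" "s \<in> U" and a: "\<And>n. a n \<in> SIM"
    and loc_s: "\<And>i j. (i, j) \<in> s \<Longrightarrow> \<beta> i = \<gamma> j"
    and loc_a: "\<And>n i j. (i, j) \<in> a n \<Longrightarrow> \<beta> i = \<gamma> j"
    and conv: "\<And>m. \<exists>N. \<forall>n\<ge>N. \<forall>i j. \<beta> i \<le> m \<longrightarrow> (i, j) \<in> a n \<longleftrightarrow> (i, j) \<in> s"
  shows "\<exists>N. \<forall>n\<ge>N. a n \<in> U"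
proof (rule ccontr)
  assume "\<not> ?thesis"
  then have bad: "\<exists>n\<ge>N. a n \<notin> U" for N by blast
  \<comment> \<open>For each \<open>m\<close> this provides a member outside \<open>U\<close> that
    agrees with \<open>s\<close> up to block \<open>m\<close>; \<open>r m\<close> will be its
    index.\<close>
  have "\<exists>n. a n \<notin> U \<and> (\<forall>i j. \<beta> i \<le> m \<longrightarrow> (i, j) \<in> a n \<longleftrightarrow> (i, j) \<in> s)" for m
    using conv[of m] bad by meson
  then obtain r where r: "\<And>m. a (r m) \<notin> U"
      "\<And>m i j. \<beta> i \<le> m \<Longrightarrow> (i, j) \<in> a (r m) \<longleftrightarrow> (i, j) \<in> s"
    by metis
  have s: "s \<in> SIM" using U open_in_SIM by blast
  let ?y = "branch_map \<beta> \<gamma> s (\<lambda>m. a (r m))"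
  let ?N = "\<lambda>A. {x \<in> SIM. branch_in \<beta> A O x O (branch_in \<gamma> A)\<inverse> \<in> U}"
  have "openin T (?N A)" for A
    by (intro openin_two_sided U) (simp_all add: branch_in_SIM)
  moreover have y: "?y B \<in> SIM" for B
    by (rule branch_map_SIM) (use s a loc_s loc_a in auto)
  moreover have "branch_in \<beta> A O ?y A O (branch_in \<gamma> A)\<inverse> = s" for A
    by (rule branch_map_conj_same)
  ultimately have "openin T (?N A) \<and> ?y A \<in> ?N A" for A
    using U by simp
  then obtain A B where AB: "A \<noteq> B" "?y B \<in> ?N A"
    by (rule no_discrete_branches)
  have "branch_in \<beta> A O ?y B O (branch_in \<gamma> A)\<inverse> = a (r (first_diff A B))"
    by (rule branch_map_conj_diff[OF r(2) AB(1)])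
  then show False using AB r(1) by simp
qed

end

section \<open>Levels and two offset partitions\<close>

lemma adjacent_half:
  fixes a b :: nat
  assumes "a \<le> Suc b" "b \<le> Suc a"
  shows "a div 2 = b div 2 \<or> Suc a div 2 = Suc b div 2"
proof -
  consider "a = b" | "a = Suc b" | "b = Suc a" using assms by linarith
  then show ?thesis by cases presburger+
qed

text \<open>Cut points are iterated so that everything related to a point below one cut lies below
  the next. The level numbers the intervals between cuts, so related points are at most one level
  apart.\<close>

lemma interval_levels:
  fixes R :: "nat \<Rightarrow> nat \<Rightarrow> bool"
  assumes fin: "\<And>x. finite {y. R x y}" "\<And>y. finite {x. R x y}"
  obtains lev :: "nat \<Rightarrow> nat" where "\<And>m. finite {x. lev x \<le> m}"
    "\<And>x y. R x y \<Longrightarrow> lev x \<le> Suc (lev y) \<and> lev y \<le> Suc (lev x)"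
proof -
  have "\<exists>m>n. \<forall>x<n. \<forall>y. R x y \<or> R y x \<longrightarrow> y < m" for n
  proof -
    have "finite ({..n} \<union> (\<Union>x<n. {y. R x y} \<union> {y. R y x}))"
      using fin by auto
    then obtain m where "\<forall>y\<in>{..n} \<union> (\<Union>x<n. {y. R x y} \<union> {y. R y x}). y < m"
      using finite_nat_set_iff_bounded by blast
    then show ?thesis by (intro exI[of _ m]) auto
  qed
  then obtain \<phi> where \<phi>: "\<And>n. n < \<phi> n" "\<And>n x y. \<lbrakk>x < n; R x y \<or> R y x\<rbrakk> \<Longrightarrow> y < \<phi> n"
    by metis
  define k where "k i = (\<phi> ^^ i) 0" for i
  have k_Suc: "k (Suc i) = \<phi> (k i)" for i by (simp add: k_def)
  have k_less: "k i < k (Suc i)" for i using \<phi>(1) by (simp add: k_Suc)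
  then have "strict_mono k" by (rule strict_monoI_Suc)
  then have k_ge: "i \<le> k i" for i by (rule strict_mono_imp_increasing)
  define lev where "lev x = (LEAST i. x < k (Suc i))" for x
  have ex: "\<exists>i. x < k (Suc i)" for x
    using k_ge[of "Suc x"] by (intro exI[of _ x]) simp
  have lev: "x < k (Suc (lev x))" for x
    unfolding lev_def using ex by (rule LeastI_ex)
  have lev_le: "lev x \<le> i" if "x < k (Suc i)" for x i
    unfolding lev_def using that by (rule Least_le)
  have step: "lev y \<le> Suc (lev x)" if "R x y \<or> R y x" for x y
    using \<phi>(2)[OF lev that] lev_le k_Suc by simp
  show ?thesis
  proof (rule that[of lev])
    show "finite {x. lev x \<le> m}" for m
    proof (rule finite_subset)
      have "x < k (Suc m)" if "lev x \<le> m" for x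
        using lev[of x] strict_mono_leD[OF \<open>strict_mono k\<close>, of "Suc (lev x)" "Suc m"] that by simp
      then show "{x. lev x \<le> m} \<subseteq> {..<k (Suc m)}" by auto
    qed simp
    show "lev x \<le> Suc (lev y) \<and> lev y \<le> Suc (lev x)" if "R x y" for x y
      using step that by blast
  qed
qed

text \<open>Here \<open>near x y\<close> is meant to say that \<open>x\<close> and \<open>y\<close> lie in the same block of a partition.
  The map is factored through two copies of \<open>\<nat>\<close>, the odd and the even numbers: the left factor
  performs the moves inside blocks, the right factor all others.\<close>

definition left_part :: "(nat \<Rightarrow> nat \<Rightarrow> bool) \<Rightarrow> (nat \<times> nat) set \<Rightarrow> (nat \<times> nat) set" where
  "left_part near h = {(x, z). \<exists>y. (x, y) \<in> h \<and> z = (if near x y then 2 * y + 1 else 2 * x)}"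

definition right_part :: "(nat \<Rightarrow> nat \<Rightarrow> bool) \<Rightarrow> (nat \<times> nat) set \<Rightarrow> (nat \<times> nat) set" where
  "right_part near h = {(z, y). \<exists>x. (x, y) \<in> h \<and> z = (if near x y then 2 * y + 1 else 2 * x)}"

lemma left_part_SIM: "h \<in> SIM \<Longrightarrow> left_part near h \<in> SIM"
  by (rule SIM_I)
    (auto simp: left_part_def Suc_double_not_eq_double double_not_eq_Suc_double
          dest: SIM_fun SIM_inj split: if_splits)

lemma right_part_SIM: "h \<in> SIM \<Longrightarrow> right_part near h \<in> SIM"
  by (rule SIM_I)
    (auto simp: right_part_def Suc_double_not_eq_double double_not_eq_Suc_double
          dest: SIM_fun SIM_inj split: if_splits)

lemma left_part_right_part:
  assumes "h \<in> SIM"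
  shows "left_part near h O right_part near h = h"
proof
  show "left_part near h O right_part near h \<subseteq> h"
    using assms
    by (auto simp: left_part_def right_part_def Suc_double_not_eq_double double_not_eq_Suc_double
          dest: SIM_fun SIM_inj split: if_splits)
  show "h \<subseteq> left_part near h O right_part near h"
  proof clarify
    fix x y assume "(x, y) \<in> h"
    then have "(x, if near x y then 2 * y + 1 else 2 * x) \<in> left_part near h"
        "(if near x y then 2 * y + 1 else 2 * x, y) \<in> right_part near h"
      unfolding left_part_def right_part_def by blast+
    then show "(x, y) \<in> left_part near h O right_part near h" by (rule relcompI)
  qed
qed

context sim_topology
begin

text \<open>Otherwise a sequence outside \<open>U\<close> converges to \<open>s\<close> in the sense
  of \<open>biagree\<close>. Each of the two factors respects a partition into finite blocks, so
  \<open>local_convergence\<close> applies to both, and continuity of the product brings the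
  sequence into \<open>U\<close>.\<close>

lemma open_biagree:
  assumes U: "openin T U" "s \<in> U"
  shows "\<exists>n. \<forall>h\<in>SIM. biagree n h s \<longrightarrow> h \<in> U"
proof (rule ccontr)
  assume "\<not> ?thesis"
  then have "\<forall>n. \<exists>h. h \<in> SIM \<and> biagree n h s \<and> h \<notin> U" by auto
  then obtain h where h: "\<And>n. h n \<in> SIM" "\<And>n. biagree n (h n) s" "\<And>n. h n \<notin> U"
    by metis
  have s: "s \<in> SIM" using U open_in_SIM by blast
  have agr: "(x, y) \<in> h n \<longleftrightarrow> (x, y) \<in> s" if "x < n \<or> y < n" for x y n
    using h(2)[of n] that by (auto simp: biagree_def)
  \<comment> \<open>The arrows of \<open>s\<close> and of the whole sequence form a locally finite
    relation: for \<open>n > x\<close> the arrows of \<open>h n\<close> at \<open>x\<close> are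
    those of \<open>s\<close>.\<close>
  define R where "R x y \<longleftrightarrow> (x, y) \<in> s \<or> (\<exists>n. (x, y) \<in> h n)" for x y
  have fin1: "finite {y. (x, y) \<in> f}" "finite {y. (y, x) \<in> f}" if "f \<in> SIM" for f x
  proof -
    have "{y. (x, y) \<in> f} = snd ` (f \<inter> {x} \<times> UNIV)" "{y. (y, x) \<in> f} = fst ` (f \<inter> UNIV \<times> {x})"
      by force+
    then show "finite {y. (x, y) \<in> f}" "finite {y. (y, x) \<in> f}"
      using SIM_finite_restrict[OF that, of "{x}"] by auto
  qed
  have "(x, y) \<in> s \<or> (\<exists>n\<le>x. (x, y) \<in> h n)" "(x, y) \<in> s \<or> (\<exists>n\<le>y. (x, y) \<in> h n)"
    if "R x y" for x y
    using that agr[of x _ y] unfolding R_def by (meson not_le)+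
  then have sub: "{y. R x y} \<subseteq> {y. (x, y) \<in> s} \<union> (\<Union>n\<le>x. {y. (x, y) \<in> h n})"
       "{y. R y x} \<subseteq> {y. (y, x) \<in> s} \<union> (\<Union>n\<le>x. {y. (y, x) \<in> h n})" for x
    by blast+
  have "finite {y. R x y}" for x
    by (rule finite_subset[OF sub(1)]) (use fin1[OF s] fin1[OF h(1)] in simp)
  moreover have "finite {y. R y x}" for x
    by (rule finite_subset[OF sub(2)]) (use fin1[OF s] fin1[OF h(1)] in simp)
  ultimately obtain lev :: "nat \<Rightarrow> nat" where lev: "\<And>m. finite {x. lev x \<le> m}"
      "\<And>x y. R x y \<Longrightarrow> lev x \<le> Suc (lev y) \<and> lev y \<le> Suc (lev x)"
    by (rule interval_levels[of R]) (rule that)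
  \<comment> \<open>Levels are paired as \<open>2k\<close>, \<open>2k+1\<close>. An arrow that
    leaves its block joins levels \<open>2k+1\<close> and \<open>2k+2\<close>, which are paired in
    the partition shifted by one.\<close>
  define near where "near x y \<longleftrightarrow> lev x div 2 = lev y div 2" for x y
  have far: "Suc (lev x) div 2 = Suc (lev y) div 2" if "R x y" "\<not> near x y" for x y
    using lev(2)[OF that(1)] that(2) adjacent_half[of "lev x" "lev y"] by (simp add: near_def)
  let ?L = "left_part near" and ?R = "right_part near"
  have bound: "\<exists>N. \<forall>n\<ge>N. \<forall>x y. lev x \<le> m \<or> lev y \<le> m \<longrightarrow> (x, y) \<in> h n \<longleftrightarrow> (x, y) \<in> s" for m
  proof -
    obtain N where "\<forall>x\<in>{x. lev x \<le> m}. x < N"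
      using lev(1) finite_nat_set_iff_bounded by blast
    then show ?thesis
      by (intro exI[of _ N]) (auto intro!: agr intro: less_le_trans)
  qed
  have "?L s O ?R s \<in> U"
    using U left_part_right_part[OF s] by simp
  then obtain V W where VW: "openin T V" "openin T W" "?L s \<in> V" "?R s \<in> W"
      "\<And>f' g'. \<lbrakk>f' \<in> V; g' \<in> W\<rbrakk> \<Longrightarrow> f' O g' \<in> U"
    using mult_nhds[OF U(1) _ left_part_SIM[OF s] right_part_SIM[OF s]] by blast
  have "\<exists>N. \<forall>n\<ge>N. ?L (h n) \<in> V"
  proof (rule local_convergence[OF VW(1,3)])
    show "?L (h n) \<in> SIM" for n by (rule left_part_SIM[OF h(1)])
    \<comment> \<open>\<open>z div 2\<close> decodes the middle point: \<open>y\<close> from the odd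
      code \<open>2 * y + 1\<close>, \<open>x\<close> from the even code
      \<open>2 * x\<close>.\<close>
    have loc: "lev x div 2 = lev (z div 2) div 2" if "(x, z) \<in> ?L f" for x z f
      using that
      by (auto simp: left_part_def near_def Suc_double_not_eq_double double_not_eq_Suc_double split: if_splits)
    show "lev x div 2 = lev (z div 2) div 2" if "(x, z) \<in> ?L s" for x z
      by (rule loc[OF that])
    show "lev x div 2 = lev (z div 2) div 2" if "(x, z) \<in> ?L (h n)" for x z n
      by (rule loc[OF that])
    fix m
    obtain N where N: "\<And>n x y. \<lbrakk>n \<ge> N; lev x \<le> 2 * m + 1\<rbrakk> \<Longrightarrow> (x, y) \<in> h n \<longleftrightarrow> (x, y) \<in> s"
      using bound[of "2 * m + 1"] by blast
    have "(x, z) \<in> ?L (h n) \<longleftrightarrow> (x, z) \<in> ?L s" if "n \<ge> N" "lev x div 2 \<le> m" for n x z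
    proof -
      have "lev x \<le> 2 * m + 1" using that(2) by linarith
      with N[OF that(1)] show ?thesis by (simp add: left_part_def)
    qed
    then show "\<exists>N. \<forall>n\<ge>N. \<forall>x z. lev x div 2 \<le> m \<longrightarrow> (x, z) \<in> ?L (h n) \<longleftrightarrow> (x, z) \<in> ?L s"
      by blast
  qed
  moreover have "\<exists>N. \<forall>n\<ge>N. ?R (h n) \<in> W"
  proof (rule local_convergence[OF VW(2,4)])
    show "?R (h n) \<in> SIM" for n by (rule right_part_SIM[OF h(1)])
    have loc: "Suc (lev (z div 2)) div 2 = Suc (lev y) div 2"
      if "(z, y) \<in> ?R f" "\<And>x y. (x, y) \<in> f \<Longrightarrow> R x y" for z y f
      using that far
      by (auto simp: right_part_def Suc_double_not_eq_double double_not_eq_Suc_double split: if_splits)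
    show "Suc (lev (z div 2)) div 2 = Suc (lev y) div 2" if "(z, y) \<in> ?R s" for z y
      using that by (rule loc) (simp add: R_def)
    show "Suc (lev (z div 2)) div 2 = Suc (lev y) div 2" if "(z, y) \<in> ?R (h n)" for z y n
      using that by (rule loc) (auto simp: R_def)
    fix m
    obtain N where N: "\<And>n x y. \<lbrakk>n \<ge> N; lev x \<le> 2 * m + 1 \<or> lev y \<le> 2 * m + 1\<rbrakk>
        \<Longrightarrow> (x, y) \<in> h n \<longleftrightarrow> (x, y) \<in> s"
      using bound[of "2 * m + 1"] by blast
    have "(z, y) \<in> ?R (h n) \<longleftrightarrow> (z, y) \<in> ?R s"
      if "n \<ge> N" "Suc (lev (z div 2)) div 2 \<le> m" for n y z
    proof -
      have *: "lev (z div 2) \<le> 2 * m + 1" using that(2) by linarith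
      \<comment> \<open>Whichever end of the arrow \<open>z div 2\<close> denotes, its level is
        bounded. Agreement is available for arrows with either end at a low level; here the
        two-sidedness matters.\<close>
      have "(x, y) \<in> h n \<longleftrightarrow> (x, y) \<in> s" if z: "z = (if near x y then 2 * y + 1 else 2 * x)" for x
      proof (rule N[OF \<open>n \<ge> N\<close>])
        show "lev x \<le> 2 * m + 1 \<or> lev y \<le> 2 * m + 1"
          using * by (cases "near x y") (simp_all add: z)
      qed
      then show ?thesis unfolding right_part_def by blast
    qed
    then show "\<exists>N. \<forall>n\<ge>N. \<forall>z y. Suc (lev (z div 2)) div 2 \<le> m \<longrightarrow> (z, y) \<in> ?R (h n) \<longleftrightarrow> (z, y) \<in> ?R s"
      by blast
  qed
  ultimately obtain n where "?L (h n) \<in> V" "?R (h n) \<in> W"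
    by (meson nle_le)
  then have "h n \<in> U"
    using VW(5) left_part_right_part[OF h(1)] by metis
  then show False using h(3) by blast
qed

end

section \<open>Open sets closed under one-sided agreement\<close>

definition swap :: "nat \<Rightarrow> nat \<Rightarrow> (nat \<times> nat) set" where
  "swap a b = {(i, if i = a then b else if i = b then a else i) | i. True}"

lemma swap_SIM: "swap a b \<in> SIM"
  by (rule SIM_I) (auto simp: swap_def split: if_splits)

lemma swap_biagree: "\<lbrakk>\<not> a < n; \<not> b < n\<rbrakk> \<Longrightarrow> biagree n (swap a b) Id"
  by (auto simp: swap_def biagree_def)

context sim_topology
begin

text \<open>T1 separates \<open>{(x, y)}\<close> and \<open>{}\<close> in both directions.
  Multiplying by \<open>{(x, x)}\<close> and \<open>{(y, y)}\<close> turns \<open>h\<close> into one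
  of these two maps.\<close>

lemma openin_mem: "openin T {h \<in> SIM. (x, y) \<in> h}"
  and openin_not_mem: "openin T {h \<in> SIM. (x, y) \<notin> h}"
proof -
  have "\<exists>U. openin T U \<and> f \<in> U \<and> g \<notin> U" if "f \<in> SIM" "g \<in> SIM" "f \<noteq> g" for f g
    using t1 that unfolding t1_space_def topspace by meson
  then obtain U V where U: "openin T U" "{(x, y)} \<in> U" "{} \<notin> U"
    and V: "openin T V" "{} \<in> V" "{(x, y)} \<notin> V"
    by (metis SIM_empty SIM_single insert_not_empty)
  have "{h \<in> SIM. {(x, x)} O h O {(y, y)} \<in> U} = {h \<in> SIM. (x, y) \<in> h}"
    using U unfolding singleton_relcomp by auto
  moreover have "{h \<in> SIM. {(x, x)} O h O {(y, y)} \<in> V} = {h \<in> SIM. (x, y) \<notin> h}"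
    using V unfolding singleton_relcomp by auto
  ultimately show "openin T {h \<in> SIM. (x, y) \<in> h}" "openin T {h \<in> SIM. (x, y) \<notin> h}"
    using openin_two_sided[OF U(1), of "{(x, x)}" "{(y, y)}"]
      openin_two_sided[OF V(1), of "{(x, x)}" "{(y, y)}"] by auto
qed

lemma openin_Range: "openin T {h \<in> SIM. y \<in> Range h}"
proof -
  have "{h \<in> SIM. y \<in> Range h} = (\<Union>x. {h \<in> SIM. (x, y) \<in> h})" by auto
  then show ?thesis using openin_mem by auto
qed

lemma openin_finite_Ball:
  assumes "finite A" "\<And>x. x \<in> A \<Longrightarrow> openin T {h \<in> SIM. P x h}"
  shows "openin T {h \<in> SIM. \<forall>x\<in>A. P x h}"
  using assms
proof (induction A rule: finite_induct)
  case empty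
  then show ?case using openin_topspace[of T] by simp
next
  case (insert a A)
  have "{h \<in> SIM. \<forall>x\<in>insert a A. P x h} = {h \<in> SIM. P a h} \<inter> {h \<in> SIM. \<forall>x\<in>A. P x h}"
    by auto
  with insert show ?case by (simp add: openin_Int)
qed

text \<open>If openness fails at \<open>a\<close> and at \<open>b\<close>, every neighbourhood of
  \<open>{}\<close> contains some \<open>{(a, y)}\<close> and some \<open>{(x, b)}\<close>, with
  \<open>y\<close> and \<open>x\<close> arbitrarily large. The swap of \<open>x\<close> and
  \<open>y\<close> is then near \<open>Id\<close> and composes them to \<open>{(a, b)}\<close>,
  against continuity at \<open>{} O Id O {} = {}\<close>.\<close>

lemma Domain_or_Range:
  "(\<forall>x. openin T {h \<in> SIM. x \<notin> Domain h}) \<or> (\<forall>y. openin T {h \<in> SIM. y \<notin> Range h})"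
proof (rule ccontr)
  assume "\<not> ?thesis"
  then obtain a b where a: "\<not> openin T {h \<in> SIM. a \<notin> Domain h}"
    and b: "\<not> openin T {h \<in> SIM. b \<notin> Range h}" by blast
  have out: "\<exists>y. {(a, y)} \<in> U" if U: "openin T U" "{} \<in> U" for U
  proof (rule ccontr)
    assume neg: "\<not> ?thesis"
    \<comment> \<open>The translate takes only the values \<open>{}\<close> and
      \<open>{(a, y)}\<close>; with none of the latter in \<open>U\<close>, the preimage of
      \<open>U\<close> would be the set that is not open.\<close>
    have "{(a, a)} O h \<in> U \<longleftrightarrow> a \<notin> Domain h" if "h \<in> SIM" for h
    proof (cases "a \<in> Domain h")
      case True
      then obtain y where "(a, y) \<in> h" by blast
      then have "{(a, a)} O h = {(a, y)}" using SIM_fun[OF that] by auto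
      with True neg show ?thesis by simp
    next
      case False
      then have "{(a, a)} O h = {}" by auto
      with False U show ?thesis by simp
    qed
    then have "{h \<in> SIM. {(a, a)} O h \<in> U} = {h \<in> SIM. a \<notin> Domain h}" by auto
    with openin_left_translation[OF U(1), of "{(a, a)}"] a show False by simp
  qed
  have into: "\<exists>x. {(x, b)} \<in> U" if U: "openin T U" "{} \<in> U" for U
  proof (rule ccontr)
    assume neg: "\<not> ?thesis"
    have "h O {(b, b)} \<in> U \<longleftrightarrow> b \<notin> Range h" if "h \<in> SIM" for h
    proof (cases "b \<in> Range h")
      case True
      then obtain x where "(x, b) \<in> h" by blast
      then have "h O {(b, b)} = {(x, b)}" using SIM_inj[OF that] by auto
      with True neg show ?thesis by simp
    next
      case False
      then have "h O {(b, b)} = {}" by auto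
      with False U show ?thesis by simp
    qed
    then have "{h \<in> SIM. h O {(b, b)} \<in> U} = {h \<in> SIM. b \<notin> Range h}" by auto
    with openin_right_translation[OF U(1), of "{(b, b)}"] b show False by simp
  qed
  let ?V = "{h \<in> SIM. (a, b) \<notin> h}"
  obtain V W where VW: "openin T V" "openin T W" "{} \<in> V" "{} \<in> W"
      "\<And>f g. \<lbrakk>f \<in> V; g \<in> W\<rbrakk> \<Longrightarrow> f O g \<in> ?V"
    by (rule mult_nhds[OF openin_not_mem[of a b], of "{}" "{}"]) auto
  obtain V' P where VP: "openin T V'" "openin T P" "{} \<in> V'" "Id \<in> P"
      "\<And>f g. \<lbrakk>f \<in> V'; g \<in> P\<rbrakk> \<Longrightarrow> f O g \<in> V"
    by (rule mult_nhds[OF VW(1), of "{}" Id]) (use VW in auto)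
  obtain n where n: "\<And>h. \<lbrakk>h \<in> SIM; biagree n h Id\<rbrakk> \<Longrightarrow> h \<in> P"
    using open_biagree[OF VP(2,4)] by blast
  \<comment> \<open>Excluding arrows from \<open>a\<close> to points below \<open>n\<close> is an
    open condition satisfied by \<open>{}\<close>; it forces \<open>y\<close> to be at least
    \<open>n\<close>.\<close>
  have "openin T (V' \<inter> {h \<in> SIM. \<forall>y\<in>{..<n}. (a, y) \<notin> h})"
    by (intro openin_Int VP openin_finite_Ball openin_not_mem finite_lessThan)
  from out[OF this] obtain y where y: "{(a, y)} \<in> V' \<inter> {h \<in> SIM. \<forall>y\<in>{..<n}. (a, y) \<notin> h}"
    using VP(3) by auto
  have "openin T (W \<inter> {h \<in> SIM. \<forall>x\<in>{..<n}. (x, b) \<notin> h})"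
    by (intro openin_Int VW openin_finite_Ball openin_not_mem finite_lessThan)
  from into[OF this] obtain x where x: "{(x, b)} \<in> W \<inter> {h \<in> SIM. \<forall>x\<in>{..<n}. (x, b) \<notin> h}"
    using VW(4) by auto
  from y x have yx: "{(a, y)} \<in> V'" "\<not> y < n" "{(x, b)} \<in> W" "\<not> x < n"
    by auto
  define \<pi> where "\<pi> = swap x y"
  have "\<pi> \<in> P"
    unfolding \<pi>_def using swap_SIM swap_biagree yx(2,4) by (intro n) auto
  then have "{(a, y)} O \<pi> \<in> V"
    using VP(5) yx(1) by blast
  then have "({(a, y)} O \<pi>) O {(x, b)} \<in> ?V"
    using VW(5) yx(3) by blast
  moreover have "(a, b) \<in> ({(a, y)} O \<pi>) O {(x, b)}"
    by (auto simp: \<pi>_def swap_def)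
  ultimately show False by blast
qed

text \<open>For \<open>s\<close> in the monoid: \<open>s\<close> lies in the
  \<open>T\<close>-closure of the maps whose range contains \<open>J\<close>.\<close>

definition hits :: "(nat \<times> nat) set \<Rightarrow> nat set \<Rightarrow> bool" where
  "hits s J \<longleftrightarrow> (\<forall>U. openin T U \<and> s \<in> U \<longrightarrow> (\<exists>h\<in>U. J \<subseteq> Range h))"

lemma hits_mono: "\<lbrakk>hits s J; K \<subseteq> J\<rbrakk> \<Longrightarrow> hits s K"
  unfolding hits_def by (meson subset_trans)

lemma hits_empty: "hits s {}"
  unfolding hits_def by blast

text \<open>Agreeing with \<open>g\<close> far enough keeps the map from
  \<open>SIM_finite_extension\<close> inside \<open>U\<close>, so maps of cofinite range are
  \<open>T\<close>-dense.\<close>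

lemma extend_in_open:
  assumes "openin T U" "g \<in> U"
  obtains g' where "g' \<in> U" "biagree l g' g" "finite (- Range g')"
proof -
  obtain n where n: "\<And>h. \<lbrakk>h \<in> SIM; biagree n h g\<rbrakk> \<Longrightarrow> h \<in> U"
    using open_biagree[OF assms] by blast
  obtain g' where g': "g' \<in> SIM" "biagree (max n l) g' g" "finite (- Range g')"
    using SIM_finite_extension[OF open_in_SIM[OF assms]] by blast
  show ?thesis
  proof (rule that)
    show "g' \<in> U" by (rule n[OF g'(1) biagree_mono[OF g'(2)]]) simp
    show "biagree l g' g" by (rule biagree_mono[OF g'(2)]) simp
  qed (rule g')
qed

end

section \<open>A base adapted to one-sided agreement\<close>

locale sim_topology_Domain = sim_topology +
  assumes openin_not_Domain: "openin T {h \<in> SIM. x \<notin> Domain h}"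
begin

lemma openin_agree:
  assumes "s \<in> SIM"
  shows "openin T {h \<in> SIM. agree n h s}"
proof -
  have *: "openin T {h \<in> SIM. \<forall>y. (x, y) \<in> h \<longleftrightarrow> (x, y) \<in> s}" for x
  proof (cases "x \<in> Domain s")
    case True
    then obtain y where "(x, y) \<in> s" by blast
    then have "{h \<in> SIM. \<forall>y. (x, y) \<in> h \<longleftrightarrow> (x, y) \<in> s} = {h \<in> SIM. (x, y) \<in> h}"
      using SIM_fun assms by blast
    then show ?thesis using openin_mem by simp
  next
    case False
    then have "{h \<in> SIM. \<forall>y. (x, y) \<in> h \<longleftrightarrow> (x, y) \<in> s} = {h \<in> SIM. x \<notin> Domain h}"
      by blast
    then show ?thesis using openin_not_Domain by simp
  qed
  have "{h \<in> SIM. agree n h s} = {h \<in> SIM. \<forall>x\<in>{..<n}. \<forall>y. (x, y) \<in> h \<longleftrightarrow> (x, y) \<in> s}"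
    by (auto simp: agree_def)
  then show ?thesis using openin_finite_Ball[OF finite_lessThan *] by simp
qed

text \<open>The composite is read off the factorization \<open>s = Id_on (Domain s) O h\<close>:
  an approximation of the first factor supplies \<open>J2 \<inter> Range h\<close> together with all but finitely many
  points, and these contain the sources through which an approximation of \<open>h\<close> reaches the rest of \<open>J2\<close>.\<close>

lemma hits_compose:
  assumes s: "s \<in> SIM" "hits s (J2 \<inter> Range h)"
    and h: "h \<in> SIM" "hits h J2"
    and sub: "s \<subseteq> h" and fin: "finite J2"
  shows "hits s J2"
  unfolding hits_def
proof (intro allI impI)
  fix U assume U: "openin T U \<and> s \<in> U"
  define J where "J = J2 \<inter> Range h"
  define D where "D = {x. \<exists>y\<in>J. (x, y) \<in> h}"
  have restrict: "y = z" if "(x, y) \<in> h" "(x, z) \<in> s" for x y z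
    using SIM_fun[OF h(1) that(1)] sub that(2) by blast
  have corestrict: "x = z" if "(x, y) \<in> h" "(z, y) \<in> s" for x y z
    using SIM_inj[OF h(1) that(1)] sub that(2) by blast
  have "Id_on (Domain s) O h = s"
    using sub by (auto simp: Id_on_iff dest: restrict)
  with U have "Id_on (Domain s) O h \<in> U" by simp
  then obtain V W where VW: "openin T V" "openin T W" "Id_on (Domain s) \<in> V" "h \<in> W"
      "\<And>f g. \<lbrakk>f \<in> V; g \<in> W\<rbrakk> \<Longrightarrow> f O g \<in> U"
    by (rule mult_nhds[OF conjunct1[OF U] _ SIM_Id_on h(1)]) blast
  \<comment> \<open>Right translation by \<open>h\<inverse>\<close> pulls the neighbourhood of the
    idempotent back to one of \<open>s\<close>, where \<open>hits\<close> can be used.\<close>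
  have "s O h\<inverse> = Id_on (Domain s)"
    using sub by (auto simp: Id_on_iff dest: corestrict)
  then have "openin T {f \<in> SIM. f O h\<inverse> \<in> V} \<and> s \<in> {f \<in> SIM. f O h\<inverse> \<in> V}"
    using openin_right_translation[OF VW(1), of "h\<inverse>"] h(1) s(1) VW(3) by simp
  then obtain f where f: "f O h\<inverse> \<in> V" "J \<subseteq> Range f"
    using s(2) unfolding hits_def J_def by blast
  have "finite J" using fin by (simp add: J_def)
  then obtain l where l: "\<And>x y. \<lbrakk>(x, y) \<in> h; y \<in> J\<rbrakk> \<Longrightarrow> x < l"
    using SIM_preimage_bound[OF h(1)] by metis
  have DR: "D \<subseteq> Range (f O h\<inverse>)"
  proof
    fix x assume "x \<in> D"
    then obtain y where y: "y \<in> J" "(x, y) \<in> h" by (auto simp: D_def)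
    then obtain w where "(w, y) \<in> f" using f(2) by blast
    with y(2) have "(w, x) \<in> f O h\<inverse>" by (intro relcompI converseI)
    then show "x \<in> Range (f O h\<inverse>)" by (rule RangeI)
  qed
  \<comment> \<open>As \<open>l\<close> exceeds all points of \<open>D\<close>, the extension to
    cofinite range still has \<open>D\<close> in its range.\<close>
  obtain f' where f': "f' \<in> V" "biagree l f' (f O h\<inverse>)" "finite (- Range f')"
    using extend_in_open[OF VW(1) f(1)] by metis
  have Df': "D \<subseteq> Range f'"
  proof
    fix x assume "x \<in> D"
    with DR l have "x < l" "x \<in> Range (f O h\<inverse>)" by (auto simp: D_def)
    then show "x \<in> Range f'" using f'(2) by (auto simp: biagree_def)
  qed
  \<comment> \<open>All points missed by \<open>f'\<close> lie below \<open>m\<close>. The map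
    \<open>g\<close> chosen next agrees with \<open>h\<close> there, so its arrows to values outside
    \<open>Range h\<close> start at points that \<open>f'\<close> reaches.\<close>
  obtain m where m: "\<forall>x\<in>- Range f'. x < m"
    using f'(3) finite_nat_set_iff_bounded by blast
  have "openin T (W \<inter> {g \<in> SIM. agree (max l m) g h}) \<and> h \<in> W \<inter> {g \<in> SIM. agree (max l m) g h}"
    using VW openin_agree h(1) by (simp add: openin_Int)
  then obtain g where g: "g \<in> W" "agree (max l m) g h" "J2 \<subseteq> Range g"
    using h(2) unfolding hits_def by blast
  have "J2 \<subseteq> Range (f' O g)"
  proof
    fix y assume y: "y \<in> J2"
    show "y \<in> Range (f' O g)"
    proof (cases "y \<in> Range h")
      case True
      then obtain x where x: "(x, y) \<in> h" by blast
      then have "x \<in> D" "x < l" using y l by (auto simp: J_def D_def)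
      then have "(x, y) \<in> g" using g(2) x by (simp add: agree_def)
      then show ?thesis using Df' \<open>x \<in> D\<close> by blast
    next
      case False
      obtain x where x: "(x, y) \<in> g" using g(3) y by blast
      have "\<not> x < m"
        using g(2) x False by (auto simp: agree_def)
      then have "x \<in> Range f'" using m by blast
      then show ?thesis using x by blast
    qed
  qed
  then show "\<exists>h\<in>U. J2 \<subseteq> Range h" using VW(5) f' g by blast
qed

text \<open>The condition on \<open>Y \<inter> Range h\<close> is inherited by subsets instead of
  prescribing this set: in an \<open>agree\<close>-limit, values in \<open>Y\<close> may be lost but
  none is gained.\<close>

definition basic :: "(nat \<times> nat) set \<Rightarrow> nat \<Rightarrow> nat set \<Rightarrow> (nat \<times> nat) set set" where
  "basic s n Y = {h \<in> SIM. agree n h s \<and> hits s (Y \<inter> Range h)}"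

text \<open>Near \<open>h\<close> the range keeps \<open>Y \<inter> Range h\<close>. A larger
  \<open>K \<subseteq> Y\<close> that \<open>s\<close> does not hit is not hit by \<open>h\<close>
  either, by \<open>hits_compose\<close>, so a neighbourhood of \<open>h\<close> avoids it; only
  finitely many \<open>K\<close> occur.\<close>

lemma openin_basic:
  assumes s: "s \<in> SIM" "Domain s \<subseteq> {..<n}" and Y: "finite Y"
  shows "openin T (basic s n Y)"
proof (subst openin_subopen, intro ballI)
  fix h assume h: "h \<in> basic s n Y"
  then have hS: "h \<in> SIM" "agree n h s" "hits s (Y \<inter> Range h)"
    by (auto simp: basic_def)
  define J where "J = Y \<inter> Range h"
  have sub: "s \<subseteq> h"
    using hS(2) s(2) by (auto simp: agree_def)
  have "\<exists>O'. openin T O' \<and> h \<in> O' \<and> (\<forall>g\<in>O'. \<not> K \<subseteq> Range g)"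
    if K: "K \<subseteq> Y" "J \<subseteq> K" "\<not> hits s K" for K
  proof -
    have "K \<inter> Range h = J" using K by (auto simp: J_def)
    then have "\<not> hits h K"
      using hits_compose[OF s(1) _ hS(1) _ sub, of K] hS(3) K finite_subset[OF K(1) Y] by (auto simp: J_def)
    then show ?thesis unfolding hits_def by blast
  qed
  then obtain N where N: "\<And>K. \<lbrakk>K \<subseteq> Y; J \<subseteq> K; \<not> hits s K\<rbrakk> \<Longrightarrow>
      openin T (N K) \<and> h \<in> N K \<and> (\<forall>g\<in>N K. \<not> K \<subseteq> Range g)"
    by metis
  let ?\<K> = "{K. K \<subseteq> Y \<and> J \<subseteq> K \<and> \<not> hits s K}"
  define W where "W = {g \<in> SIM. agree n g s} \<inter> {g \<in> SIM. \<forall>y\<in>J. y \<in> Range g} \<inter> {g \<in> SIM. \<forall>K\<in>?\<K>. g \<in> N K}"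
  have "openin T {g \<in> SIM. g \<in> N K}" if "K \<in> ?\<K>" for K
  proof -
    have "{g \<in> SIM. g \<in> N K} = N K" using N[of K] that open_in_SIM by blast
    then show ?thesis using N[of K] that by simp
  qed
  then have "openin T W"
    unfolding W_def using Y
    by (intro openin_Int openin_agree s openin_finite_Ball openin_Range)
      (auto simp: J_def)
  moreover have "h \<in> W"
    using hS N by (auto simp: W_def J_def)
  moreover have "W \<subseteq> basic s n Y"
  proof
    fix g assume g: "g \<in> W"
    have "hits s (Y \<inter> Range g)"
    proof (rule ccontr)
      assume neg: "\<not> ?thesis"
      then have *: "Y \<inter> Range g \<in> ?\<K>"
        using g by (auto simp: W_def J_def)
      then have "g \<in> N (Y \<inter> Range g)" using g by (auto simp: W_def)
      then show False using N[of "Y \<inter> Range g"] * by blast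
    qed
    with g show "g \<in> basic s n Y" by (auto simp: W_def basic_def)
  qed
  ultimately show "\<exists>W. openin T W \<and> h \<in> W \<and> W \<subseteq> basic s n Y" by blast
qed

definition agree_closed :: "(nat \<times> nat) set set \<Rightarrow> bool" where
  "agree_closed C \<longleftrightarrow> (\<forall>h\<in>SIM. (\<forall>n. \<exists>g\<in>C. agree n g h) \<longrightarrow> h \<in> C)"

text \<open>The points that \<open>h\<close> sends into \<open>Y\<close> are bounded, so a map
  agreeing with \<open>h\<close> up to that bound takes the same values in \<open>Y\<close>, and
  \<open>hits_mono\<close> applies.\<close>

lemma agree_closed_basic:
  assumes Y: "finite Y"
  shows "agree_closed (basic s n Y)"
  unfolding agree_closed_def
proof (intro ballI impI)
  fix h assume h: "h \<in> SIM" and lim: "\<forall>n'. \<exists>g\<in>basic s n Y. agree n' g h"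
  obtain m where m: "\<And>x y. \<lbrakk>(x, y) \<in> h; y \<in> Y\<rbrakk> \<Longrightarrow> x < m"
    using SIM_preimage_bound[OF h Y] by metis
  obtain g where g: "g \<in> basic s n Y" "agree (max n m) g h" using lim by blast
  have "agree n h s"
    using g agree_trans[OF agree_sym[OF agree_mono[OF g(2)]], of n s] by (simp add: basic_def)
  moreover have "Y \<inter> Range h \<subseteq> Y \<inter> Range g"
  proof clarify
    fix x y assume "(x, y) \<in> h" "y \<in> Y"
    then have "(x, y) \<in> g" using m[of x y] g(2) by (simp add: agree_def)
    then show "y \<in> Range g" by blast
  qed
  then have "hits s (Y \<inter> Range h)"
    using g(1) hits_mono by (auto simp: basic_def)
  ultimately show "h \<in> basic s n Y" using h by (simp add: basic_def)
qed

end

section \<open>Factoring the members of a basic set\<close>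

lemma SIM_finite_Image: "\<lbrakk>f \<in> SIM; finite A\<rbrakk> \<Longrightarrow> finite (f `` A)"
  using finite_imageI[OF SIM_finite_restrict(1), of f A snd] by (rule rev_finite_subset) force+

lemma SIM_Un:
  assumes "f \<in> SIM" "g \<in> SIM" "Domain f \<inter> Domain g = {}" "Range f \<inter> Range g = {}"
  shows "f \<union> g \<in> SIM"
  using assms(3,4) by (intro SIM_I) (auto dest: SIM_fun[OF assms(1)] SIM_fun[OF assms(2)]
      SIM_inj[OF assms(1)] SIM_inj[OF assms(2)])

text \<open>The middle factor \<open>g\<close> only has to reach the points of \<open>{..<j} - Range s\<close> that \<open>h\<close> reaches:
  every other move of \<open>h\<close> is routed by \<open>p\<close> and \<open>q\<close> through far away arrows of \<open>g\<close>.\<close>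

lemma factor_through:
  assumes s: "s \<in> SIM" "Domain s \<subseteq> {..<n}"
    and h: "h \<in> SIM" "agree n h s"
    and g: "g \<in> SIM" "agree n g s" "finite (- Range g)" "({..<j} - Range s) \<inter> Range h \<subseteq> Range g"
  obtains p q where "p \<in> SIM" "q \<in> SIM" "biagree n p Id" "biagree j q Id" "p O g O q = h"
proof -
  define J where "J = ({..<j} - Range s) \<inter> Range h"
  define K where "K = {..<j} \<union> Range s"
  define A where "A = {x. n \<le> x \<and> (\<exists>y. (x, y) \<in> h \<and> y \<notin> J)}"
  define B where "B = {x. n \<le> x \<and> (\<exists>y. (x, y) \<in> g \<and> y \<notin> K)}"
  have low: "(x, y) \<in> h \<longleftrightarrow> (x, y) \<in> s" "(x, y) \<in> g \<longleftrightarrow> (x, y) \<in> s" if "x < n" for x y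
    using h(2) g(2) that by (auto simp: agree_def)
  have s_low: "x < n" if "(x, y) \<in> s" for x y
    using s(2) that by blast
  have JK: "y \<in> K" "y \<notin> Range s" if "y \<in> J" for y
    using that by (auto simp: J_def K_def)
  have high: "n \<le> x" if "(x, y) \<in> h \<or> (x, y) \<in> g" "y \<in> J" for x y
    using that low JK(2) by (meson RangeI not_less)
  \<comment> \<open>Values in \<open>Range s\<close> are already taken by sources below
    \<open>n\<close>, so no other source of \<open>h\<close> reaches them.\<close>
  have K_J: "y \<in> J" if "(x, y) \<in> h" "n \<le> x" "y \<in> K" for x y
  proof -
    have "y \<notin> Range s"
    proof
      assume "y \<in> Range s"
      then obtain z where z: "(z, y) \<in> s" by blast
      then have "(z, y) \<in> h" "z < n" using low s_low by blast+
      then show False using SIM_inj[OF h(1) that(1)] that(2) by fastforce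
    qed
    then show ?thesis using that by (auto simp: J_def K_def)
  qed
  have "finite s" using s finite_subset by (blast intro: SIM_finite_Domain)
  then have "finite K" by (simp add: K_def finite_Range)
  \<comment> \<open>The range of \<open>g\<close> is infinite, whereas \<open>K\<close> and the
    image of \<open>{..<n}\<close> under \<open>g\<close> are finite.\<close>
  have "infinite B"
  proof
    assume "finite B"
    have "Range g \<subseteq> K \<union> g `` ({..<n} \<union> B)"
    proof
      fix y assume "y \<in> Range g"
      then obtain x where "(x, y) \<in> g" by blast
      then show "y \<in> K \<union> g `` ({..<n} \<union> B)"
        by (cases "x < n") (auto simp: B_def)
    qed
    moreover have "finite (g `` ({..<n} \<union> B))"
      using \<open>finite B\<close> by (intro SIM_finite_Image g) simp
    ultimately have "finite (Range g)"
      using \<open>finite K\<close> finite_subset by blast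
    with g(3) show False
      using infinite_Compl_nat by blast
  qed
  define \<theta> where "\<theta> = enumerate B"
  have \<theta>: "\<theta> x \<in> B" "\<theta> x = \<theta> y \<Longrightarrow> x = y" for x y
    using enumerate_in_set[OF \<open>infinite B\<close>] inj_enumerate[OF \<open>infinite B\<close>]
    by (auto simp: \<theta>_def dest: injD)
  have \<theta>_out: "w \<notin> K" if "(\<theta> x, w) \<in> g" for x w
    using \<theta>(1)[of x] SIM_fun[OF g(1) that] by (auto simp: B_def)
  \<comment> \<open>For values in \<open>J\<close>, \<open>u\<close> moves the source under
    \<open>h\<close> to the source under \<open>g\<close>. The other sources are sent by
    \<open>t\<close> to distinct points of \<open>B\<close>, and \<open>v\<close> redirects the
    values of \<open>g\<close> there to those of \<open>h\<close>.\<close>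
  define t where "t = {(x, \<theta> x) | x. x \<in> A}"
  define u where "u = (h \<inter> UNIV \<times> J) O g\<inverse>"
  define v where "v = (t O g)\<inverse> O h"
  define p where "p = (Id_on {..<n} \<union> u) \<union> t"
  define q where "q = Id_on K \<union> v"
  have A_J: "y \<notin> J" if "x \<in> A" "(x, y) \<in> h" for x y
    using that SIM_fun[OF h(1)] by (auto simp: A_def)
  have \<theta>_n: "n \<le> \<theta> x" for x using \<theta>(1)[of x] by (simp add: B_def)
  have tD: "n \<le> x" "n \<le> z" "x \<in> A" "z = \<theta> x" if "(x, z) \<in> t" for x z
    using that \<theta>_n by (auto simp: t_def A_def)
  have uE: "\<exists>y\<in>J. (x, y) \<in> h \<and> (z, y) \<in> g" if "(x, z) \<in> u" for x z
    using that by (auto simp: u_def)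
  have uD: "n \<le> x" "n \<le> z" if "(x, z) \<in> u" for x z
    using uE[OF that] high by blast+
  have vE: "\<exists>x\<in>A. (\<theta> x, w) \<in> g \<and> (x, y) \<in> h" if "(w, y) \<in> v" for w y
    using that by (auto simp: v_def t_def)
  have vD: "w \<notin> K" "y \<notin> K" if "(w, y) \<in> v" for w y
  proof -
    obtain x where x: "x \<in> A" "(\<theta> x, w) \<in> g" "(x, y) \<in> h" using vE[OF \<open>(w, y) \<in> v\<close>] by blast
    show "w \<notin> K" by (rule \<theta>_out[OF x(2)])
    show "y \<notin> K" using K_J[OF x(3)] A_J[OF x(1,3)] x(1) by (auto simp: A_def)
  qed
  have t: "t \<in> SIM"
    by (rule SIM_I) (auto simp: t_def dest: \<theta>(2))
  have u: "u \<in> SIM"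
    unfolding u_def using SIM_subset[OF h(1)] g(1)
    by (intro symmetric_inverse_monoid_relcomp) auto
  have v: "v \<in> SIM"
    unfolding v_def using t g(1) h(1) by (simp add: symmetric_inverse_monoid_relcomp)
  have "p \<in> SIM"
    unfolding p_def
  proof (intro SIM_Un SIM_Id_on t u)
    show "Domain (Id_on {..<n}) \<inter> Domain u = {}" "Range (Id_on {..<n}) \<inter> Range u = {}"
      using uD by fastforce+
    have "x \<notin> Domain t" if "x \<in> Domain u" for x
    proof
      assume "x \<in> Domain t"
      moreover obtain y where "y \<in> J" "(x, y) \<in> h" using \<open>x \<in> Domain u\<close> uE by blast
      ultimately show False using tD(3) A_J by blast
    qed
    then show "Domain (Id_on {..<n} \<union> u) \<inter> Domain t = {}"
      using tD(1) by fastforce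
    have "z \<notin> Range t" if "z \<in> Range u" for z
    proof
      assume "z \<in> Range t"
      then obtain x where "z = \<theta> x" using tD(4) by blast
      moreover obtain y where "y \<in> J" "(z, y) \<in> g" using \<open>z \<in> Range u\<close> uE by blast
      ultimately show False using \<theta>_out JK(1) by blast
    qed
    then show "Range (Id_on {..<n} \<union> u) \<inter> Range t = {}"
      using tD(2) by fastforce
  qed
  have "q \<in> SIM"
    unfolding q_def
    by (intro SIM_Un SIM_Id_on v) (use vD in fastforce)+
  have "biagree n p Id"
    unfolding biagree_def p_def using tD(1,2) uD by (auto simp: not_less[symmetric])
  have "biagree j q Id"
    unfolding biagree_def q_def using vD by (auto simp: K_def)
  have "p O g O q = h"
  proof -
    have "(x, y) \<in> p O g O q \<longleftrightarrow> (x, y) \<in> h" for x y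
    proof
      assume "(x, y) \<in> p O g O q"
      then obtain x' w where pgq: "(x, x') \<in> p" "(x', w) \<in> g" "(w, y) \<in> q" by blast
      from pgq(1) consider "x < n" "x' = x" | "(x, x') \<in> u" | "(x, x') \<in> t"
        by (auto simp: p_def)
      then show "(x, y) \<in> h"
      proof cases
        case 1
        then have "(x, w) \<in> s" using pgq(2) low by blast
        then have "w \<in> K" "(x, w) \<in> h" using low 1 by (auto simp: K_def)
        then show ?thesis using pgq(3) vD(1) by (auto simp: q_def)
      next
        case 2
        then obtain z where z: "z \<in> J" "(x, z) \<in> h" "(x', z) \<in> g" using uE by blast
        then have "z = w" using SIM_fun[OF g(1)] pgq(2) by blast
        then show ?thesis using pgq(3) z JK(1) vD(1) by (auto simp: q_def)
      next
        case 3
        then have "w \<notin> K" using \<theta>_out tD(4) pgq(2) by blast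
        then have "(w, y) \<in> v" using pgq(3) by (auto simp: q_def)
        then obtain z where z: "(\<theta> z, w) \<in> g" "(z, y) \<in> h" using vE by blast
        then have "\<theta> z = \<theta> x" using SIM_inj[OF g(1)] pgq(2) tD(4)[OF 3] by blast
        then show ?thesis using z \<theta>(2) by blast
      qed
    next
      assume xy: "(x, y) \<in> h"
      consider "x < n" | "y \<in> J" | "n \<le> x" "y \<notin> J" by linarith
      then show "(x, y) \<in> p O g O q"
      proof cases
        case 1
        then have "(x, x) \<in> p" "(x, y) \<in> g" "(y, y) \<in> q"
          using xy low by (auto simp: p_def q_def K_def)
        then show ?thesis by blast
      next
        case 2
        then obtain x' where "(x', y) \<in> g" using g(4) by (auto simp: J_def)
        then have "(x, x') \<in> p" "(y, y) \<in> q"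
          using 2 xy JK by (auto simp: p_def q_def u_def)
        then show ?thesis using \<open>(x', y) \<in> g\<close> by blast
      next
        case 3
        then have "x \<in> A" using xy by (auto simp: A_def)
        moreover obtain w where "(\<theta> x, w) \<in> g" using \<theta>(1)[of x] by (auto simp: B_def)
        ultimately have "(x, \<theta> x) \<in> p" "(w, y) \<in> q"
          using xy by (auto simp: p_def q_def v_def t_def)
        then show ?thesis using \<open>(\<theta> x, w) \<in> g\<close> by blast
      qed
    qed
    then show ?thesis by auto
  qed
  then show ?thesis
    using that \<open>p \<in> SIM\<close> \<open>q \<in> SIM\<close> \<open>biagree n p Id\<close> \<open>biagree j q Id\<close> by blast
qed

context sim_topology_Domain
begin

text \<open>In \<open>r = Id O r O Id\<close> take neighbourhoods \<open>P\<close>,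
  \<open>V\<close>, \<open>Q\<close> of the factors. A long restriction \<open>s\<close> of
  \<open>r\<close> lies in \<open>V\<close>, and each member of the basic set factors as
  \<open>p O g O q\<close> with factors in these neighbourhoods.\<close>

lemma open_contains_basic:
  assumes U: "openin T U" "r \<in> U"
  obtains s n Y where "s \<in> SIM" "Domain s \<subseteq> {..<n}" "finite Y" "r \<in> basic s n Y" "basic s n Y \<subseteq> U"
proof -
  have r: "r \<in> SIM" using U open_in_SIM by blast
  obtain P U1 where P: "openin T P" "openin T U1" "Id \<in> P" "r \<in> U1"
      "\<And>f g. \<lbrakk>f \<in> P; g \<in> U1\<rbrakk> \<Longrightarrow> f O g \<in> U"
    by (rule mult_nhds[OF U(1), of Id r]) (use U r in auto)
  obtain V Q where Q: "openin T V" "openin T Q" "r \<in> V" "Id \<in> Q"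
      "\<And>f g. \<lbrakk>f \<in> V; g \<in> Q\<rbrakk> \<Longrightarrow> f O g \<in> U1"
    by (rule mult_nhds[OF P(2), of r Id]) (use P r in auto)
  obtain i where i: "\<And>h. \<lbrakk>h \<in> SIM; biagree i h Id\<rbrakk> \<Longrightarrow> h \<in> P"
    using open_biagree[OF P(1,3)] by blast
  obtain j where j: "\<And>h. \<lbrakk>h \<in> SIM; biagree j h Id\<rbrakk> \<Longrightarrow> h \<in> Q"
    using open_biagree[OF Q(2,4)] by blast
  obtain l where l: "\<And>h. \<lbrakk>h \<in> SIM; biagree l h r\<rbrakk> \<Longrightarrow> h \<in> V"
    using open_biagree[OF Q(1,3)] by blast
  obtain m where m: "\<And>x y. \<lbrakk>(x, y) \<in> r; y \<in> {..<max j l}\<rbrakk> \<Longrightarrow> x < m"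
    using SIM_preimage_bound[OF r finite_lessThan] by metis
  \<comment> \<open>By the choice of \<open>m\<close>, the restriction \<open>s\<close> keeps every
    arrow of \<open>r\<close> into \<open>{..<max j l}\<close>; so it is near \<open>r\<close> from
    both sides, and \<open>Y\<close> misses the range of \<open>r\<close>.\<close>
  define n where "n = max (max i l) m"
  define s where "s = r \<inter> {..<n} \<times> UNIV"
  define Y where "Y = {..<j} - Range s"
  have s: "s \<in> SIM" "Domain s \<subseteq> {..<n}"
    using SIM_subset[OF r] by (auto simp: s_def)
  have "biagree l s r"
    using m by (fastforce simp: biagree_def s_def n_def less_max_iff_disj)
  then have "s \<in> V" using l s by blast
  have "Y \<inter> Range r = {}"
    using m by (fastforce simp: Y_def s_def n_def less_max_iff_disj)
  then have "r \<in> basic s n Y"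
    using r hits_empty by (auto simp: basic_def agree_def s_def)
  moreover have "basic s n Y \<subseteq> U"
  proof
    fix h assume "h \<in> basic s n Y"
    then have h: "h \<in> SIM" "agree n h s" "hits s (Y \<inter> Range h)"
      by (auto simp: basic_def)
    have "openin T (V \<inter> {g \<in> SIM. agree n g s}) \<and> s \<in> V \<inter> {g \<in> SIM. agree n g s}"
      using Q(1) \<open>s \<in> V\<close> s by (simp add: openin_Int openin_agree)
    then obtain f where f: "f \<in> V" "agree n f s" "Y \<inter> Range h \<subseteq> Range f"
      using h(3) unfolding hits_def by blast
    \<comment> \<open>Agreement up to \<open>max n j\<close> preserves the values at points below
      \<open>n\<close> and the reached points of \<open>Y\<close>, which lie below
      \<open>j\<close>.\<close>
    obtain g where g: "g \<in> V" "biagree (max n j) g f" "finite (- Range g)"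
      using extend_in_open[OF Q(1) f(1)] by metis
    have "agree n g s"
      using agree_trans[OF agree_mono[OF biagree_imp_agree[OF g(2)]] f(2)] by simp
    moreover have "Y \<inter> Range h \<subseteq> Range g"
    proof
      fix y assume y: "y \<in> Y \<inter> Range h"
      then obtain x where "(x, y) \<in> f" using f(3) by blast
      then show "y \<in> Range g"
        using g(2) y by (auto simp: biagree_def Y_def)
    qed
    ultimately obtain p q where pq: "p \<in> SIM" "q \<in> SIM" "biagree n p Id" "biagree j q Id" "p O g O q = h"
      using factor_through[OF s h(1,2) open_in_SIM[OF Q(1) g(1)] _ g(3), of j] by (metis Y_def)
    have "p \<in> P"
      by (rule i[OF pq(1) biagree_mono[OF pq(3)]]) (simp add: n_def)
    moreover have "q \<in> Q" by (rule j[OF pq(2,4)])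
    ultimately have "p O g O q \<in> U"
      using P(5) Q(5) g(1) by blast
    then show "h \<in> U" using pq(5) by simp
  qed
  ultimately show ?thesis using that s by (metis Y_def finite_Diff finite_lessThan)
qed

end

section \<open>An infinitely branching scheme\<close>

text \<open>Outside an agree-closed set \<open>D\<close>, the depth of \<open>h\<close> is the number of values of \<open>h\<close> that
  certify \<open>h \<notin> D\<close>. Hence the key takes countably many values, and its fibres decide membership
  in \<open>D\<close> while staying agree-closed although the complement of \<open>D\<close> need not be.\<close>

definition depth :: "(nat \<times> nat) set set \<Rightarrow> nat \<Rightarrow> (nat \<times> nat) set \<Rightarrow> nat" where
  "depth D b h = (if h \<in> D then b else LEAST k. b \<le> k \<and> (\<forall>g\<in>D. \<not> agree k g h))"

definition key :: "(nat \<times> nat) set set \<Rightarrow> nat \<Rightarrow> (nat \<times> nat) set \<Rightarrow> bool \<times> nat \<times> (nat \<times> nat) set" where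
  "key D b h = (h \<in> D, depth D b h, h \<inter> {..<depth D b h} \<times> UNIV)"

lemma restrict_eq_iff_agree: "g \<inter> {..<k} \<times> UNIV = h \<inter> {..<k} \<times> UNIV \<longleftrightarrow> agree k g h"
  by (auto simp: agree_def)

context sim_topology_Domain
begin

lemma agree_closedD:
  assumes "agree_closed C" "h \<in> SIM" "\<And>n. \<exists>g\<in>C. agree n g h"
  shows "h \<in> C"
  using assms unfolding agree_closed_def by blast

lemma depth_escape:
  assumes D: "agree_closed D" and h: "h \<in> SIM" "h \<notin> D"
  shows "b \<le> depth D b h \<and> (\<forall>g\<in>D. \<not> agree (depth D b h) g h)"
proof -
  obtain k where k: "\<forall>g\<in>D. \<not> agree k g h"
    using D h unfolding agree_closed_def by blast
  then have "b \<le> max b k \<and> (\<forall>g\<in>D. \<not> agree (max b k) g h)"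
    using agree_mono[of "max b k" _ h k] by auto
  then have "b \<le> (LEAST k. b \<le> k \<and> (\<forall>g\<in>D. \<not> agree k g h)) \<and>
      (\<forall>g\<in>D. \<not> agree (LEAST k. b \<le> k \<and> (\<forall>g\<in>D. \<not> agree k g h)) g h)"
    by (rule LeastI)
  with h(2) show ?thesis by (simp add: depth_def)
qed

lemma depth_ge: "\<lbrakk>agree_closed D; h \<in> SIM\<rbrakk> \<Longrightarrow> b \<le> depth D b h"
  using depth_escape[of D h b] by (cases "h \<in> D") (auto simp: depth_def)

lemma key_eqD: "key D b g = key D b h \<Longrightarrow> (g \<in> D \<longleftrightarrow> h \<in> D) \<and> agree (depth D b h) g h"
  by (auto simp: key_def restrict_eq_iff_agree)

text \<open>Outside \<open>D\<close>, the depth of \<open>h\<close> depends only on the arrows of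
  \<open>h\<close> starting below that depth, so agreement up to it reproduces the whole
  key.\<close>

lemma key_eq_iff:
  assumes D: "agree_closed D" and h: "h \<in> SIM"
  shows "key D b g = key D b h \<longleftrightarrow> (h \<in> D \<longrightarrow> g \<in> D) \<and> agree (depth D b h) g h"
proof
  assume "key D b g = key D b h"
  then show "(h \<in> D \<longrightarrow> g \<in> D) \<and> agree (depth D b h) g h"
    using key_eqD by blast
next
  assume *: "(h \<in> D \<longrightarrow> g \<in> D) \<and> agree (depth D b h) g h"
  show "key D b g = key D b h"
  proof (cases "h \<in> D")
    case True
    with * have "depth D b g = depth D b h" "g \<in> D" by (simp_all add: depth_def)
    with * True show ?thesis by (simp add: key_def restrict_eq_iff_agree)
  next
    case False
    let ?k = "depth D b h"
    have esc: "b \<le> ?k" "\<forall>f\<in>D. \<not> agree ?k f h"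
      using depth_escape[OF D h False] by auto
    then have g: "g \<notin> D" using * by blast
    have same: "agree k f g \<longleftrightarrow> agree k f h" if "k \<le> ?k" for k f
    proof -
      have "agree k g h" using agree_mono that * by blast
      then show ?thesis using agree_trans agree_sym by blast
    qed
    have "(LEAST k. b \<le> k \<and> (\<forall>f\<in>D. \<not> agree k f g)) = ?k"
    proof (rule Least_equality)
      show "b \<le> ?k \<and> (\<forall>f\<in>D. \<not> agree ?k f g)"
        using esc same by simp
      fix k assume k: "b \<le> k \<and> (\<forall>f\<in>D. \<not> agree k f g)"
      show "?k \<le> k"
      proof (rule ccontr)
        assume "\<not> ?k \<le> k"
        with k same[of k] have "b \<le> k \<and> (\<forall>f\<in>D. \<not> agree k f h)" by simp
        then have "?k \<le> k" using False by (auto simp: depth_def intro: Least_le)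
        with \<open>\<not> ?k \<le> k\<close> show False by simp
      qed
    qed
    then have "depth D b g = ?k" using g by (simp add: depth_def)
    with * g False show ?thesis by (simp add: key_def restrict_eq_iff_agree)
  qed
qed

text \<open>By \<open>open_biagree\<close>, membership in \<open>C\<close> is ensured by finitely
  many arrows together with absences near the origin. An arrow from a fresh source to any fresh
  value may be added to that finite part.\<close>

lemma infinite_values:
  assumes C: "openin T C" "C \<noteq> {}"
  shows "\<exists>x. infinite {y. \<exists>h\<in>C. (x, y) \<in> h}"
proof -
  obtain g where g: "g \<in> C" using C by blast
  then have gS: "g \<in> SIM" using C open_in_SIM by blast
  obtain n where n: "\<And>h. \<lbrakk>h \<in> SIM; biagree n h g\<rbrakk> \<Longrightarrow> h \<in> C"
    using open_biagree[OF C(1) g] by blast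
  define g0 where "g0 = g \<inter> {..<n} \<times> UNIV \<union> g \<inter> UNIV \<times> {..<n}"
  have g0: "g0 \<in> SIM" "finite g0"
    using SIM_subset[OF gS] SIM_finite_restrict[OF gS, of "{..<n}"] by (auto simp: g0_def)
  obtain x where x: "x \<notin> {..<n} \<union> Domain g0"
    using ex_new_if_finite[OF infinite_UNIV_nat, of "{..<n} \<union> Domain g0"] g0(2)
    by (auto simp: finite_Domain)
  have "- ({..<n} \<union> Range g0) \<subseteq> {y. \<exists>h\<in>C. (x, y) \<in> h}"
  proof
    fix y assume y: "y \<in> - ({..<n} \<union> Range g0)"
    have "g0 \<union> {(x, y)} \<in> SIM"
      using x y by (intro SIM_Un g0) auto
    moreover have "biagree n (g0 \<union> {(x, y)}) g"
      using x y by (auto simp: biagree_def g0_def)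
    ultimately show "y \<in> {y. \<exists>h\<in>C. (x, y) \<in> h}"
      using n by blast
  qed
  moreover have "infinite (- ({..<n} \<union> Range g0))"
    using g0(2) by (intro infinite_Compl_nat) (simp add: finite_Range)
  ultimately show ?thesis using finite_subset by blast
qed

definition agree_closed_opens :: "(nat \<times> nat) set set set" where
  "agree_closed_opens = {C. openin T C \<and> agree_closed C}"

text \<open>Reading past a point at which \<open>C\<close> takes infinitely many values produces
  infinitely many keys; \<open>Suc\<close> is there because \<open>agree k\<close> inspects points
  below \<open>k\<close>. The bound \<open>n\<close> makes values stabilise along the
  stages.\<close>

definition split_depth :: "(nat \<times> nat) set set \<Rightarrow> nat \<Rightarrow> nat" where
  "split_depth C n = max n (Suc (SOME x. infinite {y. \<exists>h\<in>C. (x, y) \<in> h}))"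

text \<open>A key consists of a truth value, a number and a finite map. Maps with different values
  at the point chosen in \<open>split_depth\<close> have different keys, as the depth exceeds that
  point.\<close>

lemma countable_infinite_keys:
  assumes C: "openin T C" "C \<noteq> {}" and D: "agree_closed D"
  shows "countable (key D (split_depth C n) ` C)" "infinite (key D (split_depth C n) ` C)"
proof -
  let ?key = "key D (split_depth C n)"
  have "?key ` C \<subseteq> UNIV \<times> UNIV \<times> {F. finite F}"
    using SIM_finite_restrict(1)[OF open_in_SIM[OF C(1)]] by (auto simp: key_def)
  moreover have "countable ((UNIV :: bool set) \<times> (UNIV :: nat set) \<times> {F :: (nat \<times> nat) set. finite F})"
    by (intro countable_SIGMA countable_Collect_finite) auto
  ultimately show "countable (?key ` C)" by (rule countable_subset)
  define x where "x = (SOME x. infinite {y. \<exists>h\<in>C. (x, y) \<in> h})"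
  have inf: "infinite {y. \<exists>h\<in>C. (x, y) \<in> h}"
    unfolding x_def using infinite_values[OF C] by (rule someI_ex)
  have "\<forall>y\<in>{y. \<exists>h\<in>C. (x, y) \<in> h}. \<exists>h. h \<in> C \<and> (x, y) \<in> h" by blast
  from bchoice[OF this] obtain f
    where f: "\<And>y. y \<in> {y. \<exists>h\<in>C. (x, y) \<in> h} \<Longrightarrow> f y \<in> C \<and> (x, y) \<in> f y"
    by blast
  have "inj_on (\<lambda>y. ?key (f y)) {y. \<exists>h\<in>C. (x, y) \<in> h}"
  proof (rule inj_onI)
    fix y z
    assume y: "y \<in> {y. \<exists>h\<in>C. (x, y) \<in> h}" and z: "z \<in> {y. \<exists>h\<in>C. (x, y) \<in> h}"
      and eq: "?key (f y) = ?key (f z)"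
    have fz: "f z \<in> SIM" "(x, z) \<in> f z" and fy: "f y \<in> SIM" "(x, y) \<in> f y"
      using f[OF z] f[OF y] C open_in_SIM by blast+
    have "x < split_depth C n" by (simp add: split_depth_def x_def)
    also have "\<dots> \<le> depth D (split_depth C n) (f z)"
      by (rule depth_ge[OF D fz(1)])
    finally have "(x, y) \<in> f z"
      using key_eqD[OF eq] fy by (simp add: agree_def)
    then show "y = z" using SIM_fun fz by blast
  qed
  then have "infinite ((\<lambda>y. ?key (f y)) ` {y. \<exists>h\<in>C. (x, y) \<in> h})"
    using inf finite_imageD by blast
  moreover have "(\<lambda>y. ?key (f y)) ` {y. \<exists>h\<in>C. (x, y) \<in> h} \<subseteq> ?key ` C"
    using f by blast
  ultimately show "infinite (?key ` C)"
    using finite_subset by blast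
qed

lemma key_fiber:
  assumes "C \<in> agree_closed_opens" "D \<in> agree_closed_opens" "h \<in> SIM"
  shows "{g \<in> C. key D b g = key D b h} \<in> agree_closed_opens"
proof -
  let ?k = "depth D b h"
  \<comment> \<open>For \<open>h \<notin> D\<close> the middle factor imposes nothing;
    \<open>C\<close> is a neutral placeholder.\<close>
  have eq: "{g \<in> C. key D b g = key D b h} =
      C \<inter> (if h \<in> D then D else C) \<inter> {g \<in> SIM. agree ?k g h}"
    using key_eq_iff[OF _ assms(3)] assms(1,2) open_in_SIM by (auto simp: agree_closed_opens_def)
  have "openin T {g \<in> C. key D b g = key D b h}"
    unfolding eq using assms openin_agree by (auto simp: agree_closed_opens_def)
  moreover have "agree_closed {g \<in> C. key D b g = key D b h}"
    unfolding agree_closed_def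
  proof (intro ballI impI)
    fix f assume f: "f \<in> SIM" and lim: "\<forall>n. \<exists>g\<in>{g \<in> C. key D b g = key D b h}. agree n g f"
    have lim': "\<exists>g. g \<in> C \<and> (h \<in> D \<longrightarrow> g \<in> D) \<and> agree n g f" for n
      using lim[rule_format, of n] unfolding eq by (auto split: if_splits)
    have "f \<in> C"
      by (rule agree_closedD[OF _ f]) (use assms(1) lim' in \<open>auto simp: agree_closed_opens_def\<close>)
    moreover have "f \<in> D" if "h \<in> D"
      by (rule agree_closedD[OF _ f]) (use assms(2) lim' that in \<open>auto simp: agree_closed_opens_def\<close>)
    moreover obtain g where "agree ?k g h" "agree ?k g f"
      using lim[rule_format, of ?k] unfolding eq by blast
    then have "agree ?k f h" using agree_trans agree_sym by blast
    ultimately show "f \<in> {g \<in> C. key D b g = key D b h}"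
      using key_eq_iff[OF _ assms(3)] assms(2) by (auto simp: agree_closed_opens_def)
  qed
  ultimately show ?thesis by (simp add: agree_closed_opens_def)
qed

text \<open>A partial bijection with bounded domain is finite, so the sets
  \<open>basic s n Y\<close> are indexed by finite data.\<close>

lemma countable_base:
  "\<exists>D :: nat \<Rightarrow> (nat \<times> nat) set set. (\<forall>n. D n \<in> agree_closed_opens) \<and>
     (\<forall>U h. openin T U \<longrightarrow> h \<in> U \<longrightarrow> (\<exists>n. h \<in> D n \<and> D n \<subseteq> U))"
proof -
  define \<F> where "\<F> = {basic s n Y | s n Y. s \<in> SIM \<and> Domain s \<subseteq> {..<n} \<and> finite Y}"
  have "\<F> \<subseteq> (\<lambda>(s, n, Y). basic s n Y) ` ({s. finite s} \<times> UNIV \<times> {Y. finite Y})"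
  proof
    fix C assume "C \<in> \<F>"
    then obtain s n Y where C: "C = basic s n Y" "s \<in> SIM" "Domain s \<subseteq> {..<n}" "finite Y"
      unfolding \<F>_def by blast
    then have "finite s" using finite_subset by (blast intro: SIM_finite_Domain)
    with C show "C \<in> (\<lambda>(s, n, Y). basic s n Y) ` ({s. finite s} \<times> UNIV \<times> {Y. finite Y})"
      by (intro image_eqI[of _ _ "(s, n, Y)"]) auto
  qed
  moreover have "countable ((\<lambda>(s, n, Y). basic s n Y) ` ({s. finite s} \<times> UNIV \<times> {Y. finite Y}))"
    by (intro countable_image countable_SIGMA countable_Collect_finite) auto
  ultimately have "countable \<F>" by (rule countable_subset)
  have base: "\<exists>C\<in>\<F>. h \<in> C \<and> C \<subseteq> U" if "openin T U" "h \<in> U" for U h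
  proof -
    obtain s n Y where "s \<in> SIM" "Domain s \<subseteq> {..<n}" "finite Y" "h \<in> basic s n Y" "basic s n Y \<subseteq> U"
      by (rule open_contains_basic[OF \<open>openin T U\<close> \<open>h \<in> U\<close>])
    then show ?thesis
      unfolding \<F>_def by (intro bexI[of _ "basic s n Y"] conjI CollectI exI) auto
  qed
  have "openin T SIM" using openin_topspace[of T] by simp
  then have "\<F> \<noteq> {}" using base[of SIM "{}"] by auto
  have range: "range (from_nat_into \<F>) = \<F>"
    by (rule range_from_nat_into[OF \<open>\<F> \<noteq> {}\<close> \<open>countable \<F>\<close>])
  moreover have "\<F> \<subseteq> agree_closed_opens"
    unfolding \<F>_def agree_closed_opens_def using openin_basic agree_closed_basic by blast
  ultimately have D: "from_nat_into \<F> n \<in> agree_closed_opens" for n by blast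
  show ?thesis
  proof (intro exI[of _ "from_nat_into \<F>"] conjI allI impI D)
    fix U h assume "openin T U" "h \<in> U"
    then obtain C where "C \<in> range (from_nat_into \<F>)" "h \<in> C" "C \<subseteq> U"
      using base range by metis
    then show "\<exists>n. h \<in> from_nat_into \<F> n \<and> from_nat_into \<F> n \<subseteq> U" by blast
  qed
qed

lemma decreasing_limit:
  assumes ne: "\<And>n. C n \<noteq> {}" and C: "\<And>n. C n \<in> agree_closed_opens" and dec: "\<And>n. C (Suc n) \<subseteq> C n"
    and agr: "\<And>n f g. \<lbrakk>f \<in> C (Suc n); g \<in> C (Suc n)\<rbrakk> \<Longrightarrow> agree n f g"
  shows "(\<Inter>n. C n) \<noteq> {}"
proof -
  have anti: "C n \<subseteq> C m" if "m \<le> n" for m n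
    using dec that by (rule lift_Suc_antimono_le)
  have "\<forall>n. \<exists>h. h \<in> C n" using ne by blast
  from choice[OF this] obtain f where f: "\<And>n. f n \<in> C n" by blast
  have fS: "f n \<in> SIM" for n
    using f C open_in_SIM by (auto simp: agree_closed_opens_def)
  \<comment> \<open>Members of \<open>C (Suc (Suc x))\<close> agree at all points up to
    \<open>x\<close>, so \<open>f (Suc (Suc x))\<close> already shows the limit at
    \<open>x\<close>.\<close>
  define h where "h = {(x, y). (x, y) \<in> f (Suc (Suc x))}"
  have fh: "agree n (f m) h" if "n < m" for n m
    unfolding agree_def h_def
  proof (intro allI impI)
    fix x y assume "x < n"
    then have "f m \<in> C (Suc (Suc x))" using f anti[of "Suc (Suc x)" m] that by auto
    then show "(x, y) \<in> f m \<longleftrightarrow> (x, y) \<in> {(x, y). (x, y) \<in> f (Suc (Suc x))}"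
      using agr[OF _ f, of "f m" "Suc x"] by (simp add: agree_def)
  qed
  have "h \<in> SIM"
  proof (rule SIM_I)
    fix x y z assume "(x, y) \<in> h" "(x, z) \<in> h"
    then show "y = z" using SIM_fun[OF fS] by (auto simp: h_def)
  next
    fix x y z assume "(x, z) \<in> h" "(y, z) \<in> h"
    then have "(x, z) \<in> f (Suc (Suc (max x y)))" "(y, z) \<in> f (Suc (Suc (max x y)))"
      using fh[of "Suc (max x y)" "Suc (Suc (max x y))"] by (simp_all add: agree_def)
    then show "x = y" using SIM_inj[OF fS] by blast
  qed
  have "h \<in> C n" for n
  proof -
    have "\<exists>g\<in>C n. agree k g h" for k
    proof
      show "f (max n (Suc k)) \<in> C n" using f anti[of n "max n (Suc k)"] by auto
      show "agree k (f (max n (Suc k))) h" by (rule fh) simp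
    qed
    moreover have "agree_closed (C n)" using C[of n] by (simp add: agree_closed_opens_def)
    ultimately show ?thesis using \<open>h \<in> SIM\<close> agree_closedD by blast
  qed
  then show ?thesis by blast
qed

text \<open>At stage \<open>n\<close> a cell is split by the keys for the base set
  \<open>D n\<close>. Deciding membership in \<open>D n\<close> supplies smallness; depth at least
  \<open>n\<close> makes the members of later cells agree ever further, which supplies
  completeness.\<close>

lemma homeomorphic_baire: "T homeomorphic_space baire_space"
proof -
  from countable_base obtain D :: "nat \<Rightarrow> (nat \<times> nat) set set"
    where "(\<forall>n. D n \<in> agree_closed_opens) \<and> (\<forall>U h. openin T U \<longrightarrow> h \<in> U \<longrightarrow> (\<exists>n. h \<in> D n \<and> D n \<subseteq> U))"
    by (rule exE)
  then have D: "\<And>n. D n \<in> agree_closed_opens" "\<And>U h. \<lbrakk>openin T U; h \<in> U\<rbrakk> \<Longrightarrow> \<exists>n. h \<in> D n \<and> D n \<subseteq> U"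
    by simp_all
  define \<kappa> where "\<kappa> C n = key (D n) (split_depth C n)" for C n
  \<comment> \<open>The key set of a nonempty open agree-closed cell is countably infinite, so
    \<open>to_nat_on\<close> numbers it bijectively and every number occurs as an index.\<close>
  define \<iota> where "\<iota> C n h = to_nat_on (\<kappa> C n ` C) (\<kappa> C n h)" for C n h
  have SIM_A: "h \<in> SIM" if "C \<in> agree_closed_opens" "h \<in> C" for C h
    using that open_in_SIM by (auto simp: agree_closed_opens_def)
  have keys: "countable (\<kappa> C n ` C)" "infinite (\<kappa> C n ` C)" if "C \<in> agree_closed_opens" "C \<noteq> {}" for C n
    unfolding \<kappa>_def using countable_infinite_keys[of C "D n" n] that D(1)[of n]
    by (auto simp: agree_closed_opens_def)
  have \<iota>_eq: "\<iota> C n g = \<iota> C n h \<longleftrightarrow> \<kappa> C n g = \<kappa> C n h" if "C \<in> agree_closed_opens" "g \<in> C" "h \<in> C" for C n g h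
    unfolding \<iota>_def using keys(1)[of C n] that by (subst to_nat_on_inj) auto
  have surj: "\<iota> C n ` C = UNIV" if "C \<in> agree_closed_opens" "C \<noteq> {}" for C n
    using image_to_nat_on[OF keys[OF that]] by (simp add: \<iota>_def image_image)
  have fiber: "\<exists>h\<in>C. {g \<in> C. \<iota> C n g = k} = {g \<in> C. \<kappa> C n g = \<kappa> C n h}" if "C \<in> agree_closed_opens" "C \<noteq> {}" for C n k
  proof -
    have "k \<in> \<iota> C n ` C" using surj[OF that] by simp
    then obtain h where "h \<in> C" "\<iota> C n h = k" by blast
    then show ?thesis using \<iota>_eq[OF that(1)] by (intro bexI[of _ h]) auto
  qed
  show ?thesis
  proof (rule homeomorphic_baire_space[of T agree_closed_opens \<iota>])
    show "t1_space T" by (rule t1)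
    show "topspace T \<in> agree_closed_opens"
      using openin_topspace[of T] by (auto simp: agree_closed_opens_def agree_closed_def)
    show "topspace T \<noteq> {}" unfolding topspace using SIM_empty by blast
    show "openin T C" if "C \<in> agree_closed_opens" for C using that by (simp add: agree_closed_opens_def)
    show "\<iota> C n ` C = UNIV" if "C \<in> agree_closed_opens" "C \<noteq> {}" for C n by (rule surj[OF that])
    show "{g \<in> C. \<iota> C n g = k} \<in> agree_closed_opens" if "C \<in> agree_closed_opens" "C \<noteq> {}" for C n k
    proof -
      obtain h where h: "h \<in> C" "{g \<in> C. \<iota> C n g = k} = {g \<in> C. \<kappa> C n g = \<kappa> C n h}"
        using fiber[OF \<open>C \<in> agree_closed_opens\<close> \<open>C \<noteq> {}\<close>] by blast
      show ?thesis
        unfolding h(2) unfolding \<kappa>_def by (rule key_fiber[OF that(1) D(1) SIM_A[OF that(1) h(1)]])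
    qed
    show "\<exists>n. \<forall>C\<in>agree_closed_opens. h \<in> C \<longrightarrow> {g \<in> C. \<iota> C n g = \<iota> C n h} \<subseteq> U" if U: "openin T U" "h \<in> U" for U h
    proof -
      obtain n where n: "h \<in> D n" "D n \<subseteq> U" using D(2)[OF U] by blast
      have "g \<in> U" if "C \<in> agree_closed_opens" "h \<in> C" "g \<in> C" "\<iota> C n g = \<iota> C n h" for C g
      proof -
        have "key (D n) (split_depth C n) g = key (D n) (split_depth C n) h"
          using \<iota>_eq[OF that(1,3,2), of n] that(4) by (simp add: \<kappa>_def)
        then have "g \<in> D n" using key_eqD n(1) by blast
        then show ?thesis using n(2) by blast
      qed
      then show ?thesis by blast
    qed
    show "(\<Inter>n. C n) \<noteq> {}"
      if C: "\<And>n. C n \<in> agree_closed_opens \<and> C n \<noteq> {}" "\<And>n. \<exists>k. C (Suc n) = {g \<in> C n. \<iota> (C n) n g = k}" for C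
    proof (rule decreasing_limit)
      show "C n \<noteq> {}" "C n \<in> agree_closed_opens" for n using C(1) by auto
      show "C (Suc n) \<subseteq> C n" for n using C(2)[of n] by auto
      fix n f g assume fg: "f \<in> C (Suc n)" "g \<in> C (Suc n)"
      then have "f \<in> C n" "g \<in> C n" "\<iota> (C n) n f = \<iota> (C n) n g" using C(2)[of n] by auto
      then have "\<kappa> (C n) n f = \<kappa> (C n) n g" using \<iota>_eq C(1) by blast
      then have "agree (depth (D n) (split_depth (C n) n) g) f g"
        unfolding \<kappa>_def using key_eqD by blast
      moreover have "n \<le> depth (D n) (split_depth (C n) n) g"
        using depth_ge[of "D n" g "split_depth (C n) n"] D(1)[of n] SIM_A[of "C n" g] C(1) \<open>g \<in> C n\<close>
        by (simp add: agree_closed_opens_def split_depth_def)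
      ultimately show "agree n f g" by (rule agree_mono)
    qed
  qed
qed

end

section \<open>Passing to inverses\<close>

lemma (in sim_topology) converse_topology:
  defines "T' \<equiv> pullback_topology UNIV converse T"
  shows "sim_topology T'" and "T homeomorphic_space T'"
    and "openin T U \<Longrightarrow> openin T' (converse -` U)"
proof -
  show op: "openin T' (converse -` U)" if "openin T U" for U
    using that by (auto simp: T'_def openin_pullback_topology)
  have top: "topspace T' = SIM"
    by (auto simp: T'_def topspace_pullback_topology)
  have cont: "continuous_map T' T converse"
    unfolding continuous_map_def
  proof (intro conjI allI impI)
    fix U assume U: "openin T U"
    have "{f \<in> topspace T'. f\<inverse> \<in> U} = converse -` U"
      using open_in_SIM[OF U] top SIM_converse by blast
    then show "openin T' {f \<in> topspace T'. f\<inverse> \<in> U}" using op[OF U] by simp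
  qed (simp add: top)
  have cont': "continuous_map T T' converse"
    unfolding continuous_map_def
  proof (intro conjI allI impI)
    fix V assume "openin T' V"
    then obtain U where U: "openin T U" "V = converse -` U"
      by (auto simp: T'_def openin_pullback_topology)
    then have "{f \<in> topspace T. f\<inverse> \<in> V} = U"
      using open_in_SIM by auto
    then show "openin T {f \<in> topspace T. f\<inverse> \<in> V}" using U by simp
  qed (simp add: top)
  show hom: "T homeomorphic_space T'"
    unfolding homeomorphic_space_def homeomorphic_maps_def
    using cont cont' by (intro exI[of _ converse]) auto
  \<comment> \<open>Inversion reverses products, hence the exchanged factors.\<close>
  have swap: "continuous_map (prod_topology T' T') (prod_topology T T) (\<lambda>p. ((snd p)\<inverse>, (fst p)\<inverse>))"
    using continuous_map_compose[OF continuous_map_snd cont]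
      continuous_map_compose[OF continuous_map_fst cont]
    by (intro continuous_map_pairedI) (simp_all add: o_def)
  have mult: "continuous_map (prod_topology T T) T (\<lambda>(f, g). f O g)"
    using semigroup by (simp add: semigroup_topology_on_def)
  have "continuous_map (prod_topology T' T') T'
      (converse \<circ> ((\<lambda>(f, g). f O g) \<circ> (\<lambda>p. ((snd p)\<inverse>, (fst p)\<inverse>))))"
    by (intro continuous_map_compose[OF continuous_map_compose[OF swap mult] cont'])
  moreover have "converse \<circ> ((\<lambda>(f, g). f O g) \<circ> (\<lambda>p. ((snd p)\<inverse>, (fst p)\<inverse>))) =
      (\<lambda>(f :: (nat \<times> nat) set, g :: (nat \<times> nat) set). f O g)"
    by (auto simp: fun_eq_iff converse_relcomp)
  ultimately have "continuous_map (prod_topology T' T') T' (\<lambda>(f, g). f O g)" by simp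
  then show "sim_topology T'"
    using top t1 second_countable hom
    by (simp add: sim_topology_def semigroup_topology_on_def homeomorphic_t1_space
        homeomorphic_space_second_countability)
qed

theorem theorem2p5:
  fixes T :: "(nat \<times> nat) set topology"
  assumes "semigroup_topology_on symmetric_inverse_monoid (O) T"
    and "t1_space T"
    and "second_countable T"
  shows "T homeomorphic_space baire_space"
proof -
  interpret sim_topology T
    using assms by unfold_locales
  show ?thesis
  proof (cases "\<forall>x. openin T {h \<in> SIM. x \<notin> Domain h}")
    case True
    then interpret sim_topology_Domain T
      by unfold_locales blast
    show ?thesis by (rule homeomorphic_baire)
  next
    case False
    then have ran: "openin T {h \<in> SIM. y \<notin> Range h}" for y
      using Domain_or_Range by blast
    let ?T' = "pullback_topology UNIV converse T"
    interpret T': sim_topology ?T' by (rule converse_topology)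
    interpret T': sim_topology_Domain ?T'
    proof
      fix x
      have "converse -` {h \<in> SIM. x \<notin> Range h} = {h \<in> SIM. x \<notin> Domain h}" by auto
      then show "openin ?T' {h \<in> SIM. x \<notin> Domain h}"
        using converse_topology(3)[OF ran[of x]] by simp
    qed
    show ?thesis
      using homeomorphic_space_trans[OF converse_topology(2) T'.homeomorphic_baire] .
  qed
qed

end
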